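(* Let $N$ be a positive integer. Suppose that $A,B\subset\mathbb{Z}/N\mathbb{Z}$ are non-empty sets with $|A+B|\leq K|B|$, and that $A$ has density $\alpha=|A|/N\in(0,1)$. Then there are sets $\Gamma,\Lambda$ of characters on $\mathbb{Z}/N\mathbb{Z}$ and $\delta,\epsilon\in(0,1]$ such that $(A-A)+(B-B)$ contains $B(\Gamma,\delta)\cap B(\Lambda,\epsilon)$, where $$|\Gamma|=O(K^{1/2}\log\alpha^{-1}) \quad\text{and}\quad \log\delta^{-1}=O(K^{1/4}\log\alpha^{-1}\,\log(K\alpha^{-1}))$$ and $$|\Lambda|=O(K^{3/4}\log\alpha^{-1}) \quad\text{and}\quad \log\epsilon^{-1}=O(\log(K\log\alpha^{-1})).$$
   Context: Here $X=O(Y)$ means $|X|\leq C|Y|$ for an absolute constant $C$ (independent of $N,A,B,K,\alpha$). A character on $\mathbb{Z}/N\mathbb{Z}$ is a homomorphism $\gamma:\mathbb{Z}/N\mathbb{Z}\to\{z\in\mathbb{C}:|z|=1\}$. For $z=e^{2\pi i\theta}$ with $\theta\in\mathbb{R}$, $\|z\|$ denotes the distance from $\theta$ to the nearest integer. For a set $\Gamma$ of characters on $\mathbb{Z}/N\mathbb{Z}$ and $\delta\in(0,1]$, the Bohr set is $$B(\Gamma,\delta):=\{x\in\mathbb{Z}/N\mathbb{Z}: \|\gamma(x)\|\leq\delta \text{ for all }\gamma\in\Gamma\}.$$ Sum and difference sets are $X\pm Y=\{x\pm y:x\in X,y\in Y\}$. *)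

theory Defs
  imports "HOL-Algebra.Elementary_Groups" "HOL-Analysis.Analysis"
begin

text \<open>
  The group \<open>\<int>/N\<int>\<close> is the library's \<^const>\<open>integer_mod_group\<close>: its carrier is \<open>{0..<int N}\<close>
  for \<open>N > 0\<close> and its operation, written multiplicatively in HOL-Algebra, is addition modulo \<open>N\<close>.
  Hence \<open>X + Y\<close> is \<^const>\<open>set_mult\<close>, and \<open>X - Y\<close> is the set below.
\<close>

definition diff_set :: "('a, 'b) monoid_scheme \<Rightarrow> 'a set \<Rightarrow> 'a set \<Rightarrow> 'a set" where
  "diff_set G X Y = {x \<otimes>\<^bsub>G\<^esub> inv\<^bsub>G\<^esub> y | x y. x \<in> X \<and> y \<in> Y}"

definition circle_group :: "complex monoid" where
  "circle_group = \<lparr>carrier = {z. cmod z = 1}, monoid.mult = (*), one = 1\<rparr>"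

text \<open>
  Functions in \<^const>\<open>hom\<close> are unconstrained off the carrier; extensionality makes equal
  characters equal as functions, so that cardinalities of sets of characters are the intended ones.
\<close>

definition characters :: "nat \<Rightarrow> (int \<Rightarrow> complex) set" where
  "characters N = hom (integer_mod_group N) circle_group
     \<inter> extensional (carrier (integer_mod_group N))"

text \<open>
  The distance from \<open>\<theta>\<close> to the nearest integer, for \<open>z = exp (2 \<pi> \<i> \<theta>)\<close>; any choice of \<open>\<theta>\<close>
  gives the same value (\<open>circle_norm_cis\<close> below), and \<open>Arg z / (2 \<pi>)\<close> is one.
\<close>

definition circle_norm :: "complex \<Rightarrow> real" where
  "circle_norm z = infdist (Arg z / (2 * pi)) \<int>"

definition bohr_set :: "nat \<Rightarrow> (int \<Rightarrow> complex) set \<Rightarrow> real \<Rightarrow> int set" where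
  "bohr_set N \<Gamma> \<delta> = {x \<in> carrier (integer_mod_group N). \<forall>\<gamma>\<in>\<Gamma>. circle_norm (\<gamma> x) \<le> \<delta>}"

lemma infdist_Ints_add_of_int: "infdist (x + of_int k) \<int> = infdist (x :: real) \<int>"
proof -
  have le: "infdist (y + of_int m) \<int> \<le> infdist y \<int>" for y :: real and m
  proof -
    have "infdist (y + of_int m) \<int> \<le> dist y a" if "a \<in> \<int>" for a
      using infdist_le[of "a + of_int m" \<int> "y + of_int m"] that by (simp add: dist_real_def)
    moreover have "(\<int> :: real set) \<noteq> {}"
      using Ints_0 by blast
    ultimately show ?thesis
      using infdist_notempty[of \<int> y] by (auto intro: cINF_greatest)
  qed
  show ?thesis
    using le[of x k] le[of "x + of_int k" "-k"] by simp
qed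

lemma circle_norm_cis: "circle_norm (cis (2 * pi * \<theta>)) = infdist \<theta> \<int>"
proof -
  define t where "t = Arg (cis (2 * pi * \<theta>))"
  have "cis t = cis (2 * pi * \<theta>)"
    by (simp add: t_def cis_Arg sgn_div_norm)
  then obtain k :: int where "t = 2 * pi * \<theta> + 2 * pi * k"
    using sin_cos_eq_iff[of t "2 * pi * \<theta>"] by (auto simp: complex_eq_iff)
  then have "t / (2 * pi) = \<theta> + of_int k"
    by (simp add: field_simps)
  then show ?thesis
    by (simp add: circle_norm_def infdist_Ints_add_of_int flip: t_def)
qed

lemma finite_characters:
  assumes "N > 0"
  shows "finite (characters N)"
proof -
  let ?G = "integer_mod_group N"
  have car: "carrier ?G = {0..<int N}"
    using assms by (simp add: integer_mod_group_def)
  have circ: "group circle_group"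
  proof (rule groupI)
    fix z assume "z \<in> carrier circle_group"
    then show "\<exists>w\<in>carrier circle_group. w \<otimes>\<^bsub>circle_group\<^esub> z = \<one>\<^bsub>circle_group\<^esub>"
      by (intro bexI[of _ "inverse z"])
        (auto simp: circle_group_def norm_inverse intro!: left_inverse)
  qed (auto simp: circle_group_def norm_mult)
  have circ_pow: "z [^]\<^bsub>circle_group\<^esub> (n :: nat) = z ^ n" for z n
    by (induction n) (auto simp: circle_group_def nat_pow_def mult.commute)
  have "\<gamma> x ^ N = 1" if g: "\<gamma> \<in> hom ?G circle_group" and x: "x \<in> carrier ?G" for \<gamma> x
  proof -
    have "\<gamma> x [^]\<^bsub>circle_group\<^esub> N = \<gamma> (x [^]\<^bsub>?G\<^esub> N)"
      by (rule hom_nat_pow[OF g x group_integer_mod_group circ, symmetric])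
    also have "x [^]\<^bsub>?G\<^esub> N = \<one>\<^bsub>?G\<^esub>"
      by simp
    also have "\<gamma> \<one>\<^bsub>?G\<^esub> = \<one>\<^bsub>circle_group\<^esub>"
      by (rule hom_one[OF g _ circ]) simp
    finally show ?thesis
      by (simp add: circ_pow) (simp add: circle_group_def)
  qed
  then have "characters N \<subseteq> carrier ?G \<rightarrow>\<^sub>E {z. z ^ N = 1}"
    by (auto simp: characters_def PiE_def)
  moreover have "finite (carrier ?G \<rightarrow>\<^sub>E {z :: complex. z ^ N = 1})"
    using assms by (intro finite_PiE finite_roots_unity) (auto simp: car)
  ultimately show ?thesis
    by (rule finite_subset)
qed

end

theory Submission imports Defs "HOL-Library.Real_Mod" begin

text \<open>
  One Bohr set suffices, so \<open>\<Lambda>\<close> is taken empty and \<open>\<epsilon> = 1\<close>. Put \<open>S = A + B\<close> and let \<open>h(x)\<close> be the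
  proportion of \<open>b \<in> B\<close> with \<open>x + b \<in> S\<close>; then \<open>h = 1\<close> on \<open>A\<close>, and \<open>w \<in> (A - A) + (B - B)\<close> as soon
  as \<open>h(a + w) > 0\<close> for one \<open>a \<in> A\<close>. By the sampling argument of Croot and Sisask, \<open>A\<close> contains a
  large set \<open>T\<close> of translates under which \<open>h\<close> is almost invariant, up to \<open>\<eta>\<close> and outside a set that
  is small compared with \<open>A\<close>; about \<open>\<eta>\<^sup>-\<^sup>2 log (1/\<alpha>)\<close> samples are enough, whence
  \<open>log (N/|T|) = O((log 2K)\<^sup>4 log (1/\<alpha>))\<close> with \<open>1/\<eta>\<close> of order \<open>log 2K\<close>. Averaging \<open>h\<close> over \<open>k\<close>
  differences from \<open>T - T\<close>, with \<open>k\<close> of order \<open>log 2K\<close>, changes it little and damps all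
  frequencies outside the large spectrum of \<open>T\<close> by a factor \<open>4\<^sup>-\<^sup>k\<close>. By Chang's theorem the large
  spectrum is spanned by \<open>O(log (N/|T|))\<close> characters, and these define the Bohr set. The resulting
  rank \<open>O((log 2K)\<^sup>4 log (1/\<alpha>))\<close> is within \<open>O(K\<^sup>1\<^sup>/\<^sup>4 log (1/\<alpha>))\<close>. If \<open>\<alpha> > 1/2\<close> then \<open>A - A\<close> is the
  whole group.
\<close>

section \<open>Elementary inequalities\<close>

lemma exp_le_quadratic:
  fixes x :: real
  assumes "\<bar>x\<bar> \<le> 1"
  shows "exp x \<le> 1 + x + x\<^sup>2"
proof (cases "x \<ge> 0")
  case True
  then show ?thesis using exp_bound assms by auto
next
  case False
  define y where "y = - x"
  have y: "0 < y" "y \<le> 1" using False assms by (auto simp: y_def)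
  have "1 + y + y\<^sup>2 / 2 \<le> exp y" using y by (intro exp_lower_Taylor_quadratic) auto
  \<comment> \<open>Since exp (- y) = 1 / exp y, it is enough that (1 - y + y^2) exp y \<ge> 1; the
    quadratic Taylor polynomial in place of exp y already gives this.\<close>
  moreover have "(1 - y + y\<^sup>2) * (1 + y + y\<^sup>2 / 2) = 1 + y\<^sup>2 / 2 + y ^ 3 / 2 + y ^ 4 / 2"
    by (simp add: field_simps power2_eq_square power3_eq_cube power4_eq_xxxx)
  ultimately have "1 \<le> (1 - y + y\<^sup>2) * exp y"
    using y mult_left_mono[of "1 + y + y\<^sup>2 / 2" "exp y" "1 - y + y\<^sup>2"]
    by (smt (verit) zero_le_power2 zero_le_power divide_nonneg_nonneg)
  then show ?thesis
    by (simp add: y_def exp_minus field_simps)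
qed

text \<open>A moment bound of Hoeffding type: after the quadratic bound for exp the linear terms
  cancel because the mean is zero.\<close>

lemma sum_exp_le:
  fixes Y :: "'b \<Rightarrow> real"
  assumes Y: "\<And>b. b \<in> B \<Longrightarrow> \<bar>Y b\<bar> \<le> 1" and mean: "(\<Sum>b\<in>B. Y b) = 0" and s: "\<bar>s\<bar> \<le> 1"
  shows "(\<Sum>b\<in>B. exp (s * Y b)) \<le> card B * exp (s\<^sup>2)"
proof -
  have "exp (s * Y b) \<le> 1 + s * Y b + s\<^sup>2" if "b \<in> B" for b
  proof -
    have "\<bar>s * Y b\<bar> \<le> 1"
      using mult_mono[OF s Y[OF that]] by (simp add: abs_mult)
    moreover have "(s * Y b)\<^sup>2 \<le> s\<^sup>2"
      using Y[OF that] by (simp add: power_mult_distrib mult_left_le abs_square_le_1)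
    ultimately show ?thesis using exp_le_quadratic[of "s * Y b"] by linarith
  qed
  then have "(\<Sum>b\<in>B. exp (s * Y b)) \<le> (\<Sum>b\<in>B. 1 + s * Y b + s\<^sup>2)"
    by (rule sum_mono)
  also have "\<dots> = card B * (1 + s\<^sup>2)"
    by (simp add: sum.distrib mean flip: sum_distrib_left) (simp add: algebra_simps)
  also have "\<dots> \<le> card B * exp (s\<^sup>2)"
    by (intro mult_left_mono exp_ge_add_one_self) auto
  finally show ?thesis .
qed

text \<open>The coordinates of a tuple vary independently, so the sum of products factors into a
  product of one-variable sums.\<close>

lemma sum_tuples_exp_le:
  fixes Y :: "'b \<Rightarrow> real"
  assumes B: "finite B" and Y: "\<And>b. b \<in> B \<Longrightarrow> \<bar>Y b\<bar> \<le> 1" and mean: "(\<Sum>b\<in>B. Y b) = 0"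
    and s: "\<bar>s\<bar> \<le> 1"
  shows "(\<Sum>z\<in>{..<m} \<rightarrow>\<^sub>E B. exp (s * (\<Sum>i<m. Y (z i)))) \<le> card B ^ m * exp (m * s\<^sup>2)"
proof -
  have "(\<Sum>z\<in>{..<m} \<rightarrow>\<^sub>E B. exp (s * (\<Sum>i<m. Y (z i))))
      = (\<Sum>z\<in>{..<m} \<rightarrow>\<^sub>E B. \<Prod>i<m. exp (s * Y (z i)))"
    by (simp add: sum_distrib_left exp_sum)
  also have "\<dots> = (\<Prod>i<m. \<Sum>b\<in>B. exp (s * Y b))"
    using B by (subst prod_sum_PiE) auto
  also have "\<dots> \<le> (\<Prod>i<m. card B * exp (s\<^sup>2))"
    using sum_exp_le[OF Y mean s] by (intro prod_mono) (auto intro: sum_nonneg)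
  also have "\<dots> = card B ^ m * exp (m * s\<^sup>2)"
    by (simp add: power_mult_distrib exp_of_nat_mult)
  finally show ?thesis .
qed

text \<open>Chernoff's method, applied to the mean excess over \<eta> rather than to a
  probability.\<close>

lemma sum_tuples_deviation_le:
  fixes Y :: "'b \<Rightarrow> real"
  assumes B: "finite B" and Y: "\<And>b. b \<in> B \<Longrightarrow> \<bar>Y b\<bar> \<le> 1" and mean: "(\<Sum>b\<in>B. Y b) = 0"
    and \<eta>: "0 < \<eta>" "\<eta> \<le> 1" and m: "2 \<le> \<eta> * m"
  shows "(\<Sum>z\<in>{..<m} \<rightarrow>\<^sub>E B. max 0 (\<bar>(\<Sum>i<m. Y (z i)) / m\<bar> - \<eta>))
           \<le> 2 * exp (- (\<eta>\<^sup>2 * m / 4)) * card B ^ m"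
proof -
  have m0: "m > 0" using m by (cases m) auto
  \<comment> \<open>\<open>exp (v * x)\<close> dominates \<open>max 0 x\<close> as soon as v \<ge>
    1, which 2 \<le> \<eta> m ensures. With s = v / m the total exponent is m s^2 - v \<eta>; this v
    minimises it, with value - \<eta>^2 m / 4.\<close>
  define v where "v = \<eta> * m / 2"
  have v: "v \<ge> 1" using m by (simp add: v_def)
  define s where "s = \<eta> / 2"
  have vs: "v / m = s" using m0 by (simp add: v_def s_def)
  have s: "\<bar>s\<bar> \<le> 1" "\<bar>-s\<bar> \<le> 1" using \<eta> by (auto simp: s_def)
  have z: "max 0 x \<le> exp (v * x)" for x :: real
  proof (cases "x \<ge> 0")
    case True
    then have "x \<le> v * x" using v mult_right_mono[of 1 v x] by simp
    also have "\<dots> \<le> exp (v * x)" using exp_ge_add_one_self[of "v * x"] by linarith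
    finally show ?thesis using True by auto
  qed auto
  have "max 0 (\<bar>S / m\<bar> - \<eta>) \<le> exp (-(v * \<eta>)) * (exp (s * S) + exp (- s * S))" for S :: real
  proof -
    have "max 0 (\<bar>S / m\<bar> - \<eta>) \<le> exp (v * (\<bar>S / m\<bar> - \<eta>))" by (rule z)
    also have "v * (\<bar>S / m\<bar> - \<eta>) = - (v * \<eta>) + s * \<bar>S\<bar>"
      using m0 by (simp add: algebra_simps flip: vs)
    also have "exp \<dots> \<le> exp (-(v * \<eta>)) * (exp (s * S) + exp (- s * S))"
      unfolding exp_add by (intro mult_left_mono) (cases "S \<ge> 0"; simp)+
    finally show ?thesis .
  qed
  then have "(\<Sum>z\<in>{..<m} \<rightarrow>\<^sub>E B. max 0 (\<bar>(\<Sum>i<m. Y (z i)) / m\<bar> - \<eta>))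
    \<le> (\<Sum>z\<in>{..<m} \<rightarrow>\<^sub>E B. exp (-(v * \<eta>)) * (exp (s * (\<Sum>i<m. Y (z i))) + exp (- s * (\<Sum>i<m. Y (z i)))))"
    by (rule sum_mono)
  also have "\<dots> = exp (-(v * \<eta>)) * ((\<Sum>z\<in>{..<m} \<rightarrow>\<^sub>E B. exp (s * (\<Sum>i<m. Y (z i))))
       + (\<Sum>z\<in>{..<m} \<rightarrow>\<^sub>E B. exp (- s * (\<Sum>i<m. Y (z i)))))"
    by (simp add: sum_distrib_left sum.distrib distrib_left)
  also have "\<dots> \<le> exp (-(v * \<eta>)) * (card B ^ m * exp (m * s\<^sup>2) + card B ^ m * exp (m * (-s)\<^sup>2))"
    by (intro mult_left_mono add_mono sum_tuples_exp_le B Y mean s) auto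
  also have "\<dots> = 2 * (exp (-(v * \<eta>)) * exp (m * s\<^sup>2)) * card B ^ m"
    by (simp add: algebra_simps)
  also have "exp (-(v * \<eta>)) * exp (m * s\<^sup>2) = exp (- (\<eta>\<^sup>2 * m / 4))"
    by (simp add: v_def s_def power2_eq_square field_simps flip: exp_add)
  finally show ?thesis .
qed

lemma norm_cis_diff_1_le: "norm (cis t - 1) \<le> \<bar>t\<bar>"
proof -
  have "(norm (cis t - 1))\<^sup>2 = (cos t - 1)\<^sup>2 + (sin t)\<^sup>2"
    by (simp add: cmod_power2)
  also have "\<dots> = 2 - 2 * cos t"
    using sin_cos_squared_add[of t] by (simp add: power2_eq_square algebra_simps)
  also have "\<dots> = (2 * sin (t / 2))\<^sup>2"
    using cos_double_sin[of "t / 2"] by (simp add: power_mult_distrib)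
  finally have "(norm (cis t - 1))\<^sup>2 = \<bar>2 * sin (t / 2)\<bar>\<^sup>2" by simp
  then have "norm (cis t - 1) = \<bar>2 * sin (t / 2)\<bar>"
    by (rule power2_eq_imp_eq) auto
  then show ?thesis using abs_sin_x_le_abs_x[of "t / 2"] by (simp add: abs_mult)
qed

section \<open>Truncated distance on the cyclic group\<close>

locale cyclic =
  fixes N :: nat
  assumes N_pos: "N > 0"
begin

text \<open>One number for "at most c outside a small set". Unlike a count of exceptional points it
  is subadditive, with thresholds adding up, and convex, so it survives triangle inequalities and
  averaging.\<close>

definition excess :: "real \<Rightarrow> (int \<Rightarrow> 'a::real_normed_vector) \<Rightarrow> real" where
  "excess c f = (\<Sum>x\<in>{0..<int N}. max 0 (norm (f x) - c))"

text \<open>Functions on the cyclic group are kept as N-periodic functions on the integers, so that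
  shifts need no reduction modulo N.\<close>

definition periodic :: "(int \<Rightarrow> 'a) \<Rightarrow> bool" where
  "periodic f \<longleftrightarrow> (\<forall>x. f (x mod int N) = f x)"

lemma periodic_shift: "periodic f \<Longrightarrow> periodic (\<lambda>x. f (x + u))"
  unfolding periodic_def by (metis mod_add_left_eq)

lemma bij_betw_shift: "bij_betw (\<lambda>x. (x + u) mod int N) {0..<int N} {0..<int N}"
proof (rule bij_betwI[where g = "\<lambda>x. (x - u) mod int N"])
  show "((x + u) mod int N - u) mod int N = x" if "x \<in> {0..<int N}" for x
    using that by (simp add: mod_diff_left_eq)
  show "((x - u) mod int N + u) mod int N = x" if "x \<in> {0..<int N}" for x
    using that by (simp add: mod_add_left_eq)
qed (use N_pos in auto)

lemma sum_shift:
  assumes "periodic f"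
  shows "(\<Sum>x\<in>{0..<int N}. f (x + u)) = (\<Sum>x\<in>{0..<int N}. f x)"
proof -
  have "(\<Sum>x\<in>{0..<int N}. f (x + u)) = (\<Sum>x\<in>{0..<int N}. f ((x + u) mod int N))"
    using assms by (simp add: periodic_def)
  also have "\<dots> = (\<Sum>x\<in>{0..<int N}. f x)"
    by (rule sum.reindex_bij_betw[OF bij_betw_shift])
  finally show ?thesis .
qed

lemma excess_shift:
  assumes "periodic f"
  shows "excess c (\<lambda>x. f (x + u)) = excess c f"
  unfolding excess_def
  by (rule sum_shift[where f = "\<lambda>x. max 0 (norm (f x) - c)"]) (use assms in \<open>simp add: periodic_def\<close>)

lemma excess_add: "excess (c + d) (\<lambda>x. f x + g x) \<le> excess c f + excess d g"
proof -
  have "max 0 (norm (f x + g x) - (c + d)) \<le> max 0 (norm (f x) - c) + max 0 (norm (g x) - d)" for x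
    using norm_triangle_ineq[of "f x" "g x"] by linarith
  then show ?thesis
    unfolding excess_def sum.distrib[symmetric] by (rule sum_mono)
qed

lemma excess_minus_commute: "excess c (\<lambda>x. f x - g x) = excess c (\<lambda>x. g x - f x)"
  by (simp add: excess_def norm_minus_commute)

text \<open>Convexity of \<open>max 0 (norm v - c)\<close> in the vector v.\<close>

lemma excess_average:
  assumes I: "finite I" "I \<noteq> {}" and le: "\<And>i. i \<in> I \<Longrightarrow> excess c (f i) \<le> M"
  shows "excess c (\<lambda>x. (\<Sum>i\<in>I. f i x) /\<^sub>R card I) \<le> M"
proof -
  have c0: "real (card I) > 0" using I by (simp add: card_gt_0_iff)
  have "max 0 (norm ((\<Sum>i\<in>I. f i x) /\<^sub>R card I) - c)
      \<le> (\<Sum>i\<in>I. max 0 (norm (f i x) - c)) / card I" for x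
  proof -
    have "norm ((\<Sum>i\<in>I. f i x) /\<^sub>R card I) - c = (norm (\<Sum>i\<in>I. f i x) - card I * c) / card I"
      using c0 by (simp add: field_simps)
    also have "\<dots> \<le> ((\<Sum>i\<in>I. norm (f i x)) - card I * c) / card I"
      using c0 by (intro divide_right_mono diff_right_mono norm_sum) auto
    also have "(\<Sum>i\<in>I. norm (f i x)) - card I * c = (\<Sum>i\<in>I. norm (f i x) - c)"
      by (simp add: sum_subtractf)
    also have "\<dots> / card I \<le> (\<Sum>i\<in>I. max 0 (norm (f i x) - c)) / card I"
      by (intro divide_right_mono sum_mono) auto
    finally show ?thesis by (auto intro!: divide_nonneg_nonneg sum_nonneg)
  qed
  then have "excess c (\<lambda>x. (\<Sum>i\<in>I. f i x) /\<^sub>R card I)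
      \<le> (\<Sum>x\<in>{0..<int N}. (\<Sum>i\<in>I. max 0 (norm (f i x) - c)) / card I)"
    unfolding excess_def by (rule sum_mono)
  also have "\<dots> = (\<Sum>i\<in>I. excess c (f i)) / card I"
    by (simp add: excess_def flip: sum_divide_distrib) (subst sum.swap, simp)
  also have "\<dots> \<le> (\<Sum>i\<in>I. M) / card I"
    using le by (intro divide_right_mono sum_mono) auto
  also have "\<dots> = M" using c0 by simp
  finally show ?thesis .
qed

section \<open>Almost periods\<close>

definition ind :: "int set \<Rightarrow> int \<Rightarrow> real" where
  "ind S y = of_bool (y mod int N \<in> S)"

lemma ind_range: "0 \<le> ind S y" "ind S y \<le> 1"
  by (auto simp: ind_def)

lemma periodic_ind: "periodic (ind S)"
  by (simp add: periodic_def ind_def)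

lemma ind_cong: "x mod int N = y mod int N \<Longrightarrow> ind S x = ind S y"
  by (simp add: ind_def)

text \<open>This is the function h of the opening idea.\<close>

definition avg_ind :: "int set \<Rightarrow> int set \<Rightarrow> int \<Rightarrow> real" where
  "avg_ind S B x = (\<Sum>b\<in>B. ind S (x + b)) / card B"

lemma periodic_avg_ind: "periodic (avg_ind S B)"
  unfolding periodic_def avg_ind_def
  by (auto intro!: sum.cong arg_cong2[where f = "(/)"] ind_cong simp: mod_add_left_eq)

lemma avg_ind_range: "0 \<le> avg_ind S B x" "avg_ind S B x \<le> 1"
proof -
  show "0 \<le> avg_ind S B x"
    unfolding avg_ind_def by (intro divide_nonneg_nonneg sum_nonneg ind_range) auto
  have "(\<Sum>b\<in>B. ind S (x + b)) \<le> (\<Sum>b\<in>B. 1)" by (intro sum_mono ind_range)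
  then show "avg_ind S B x \<le> 1"
    by (cases "card B = 0") (auto simp: avg_ind_def field_simps)
qed

text \<open>An empirical estimate of \<open>avg_ind\<close> from m sample points in place of all of
  B.\<close>

definition sample_ind :: "int set \<Rightarrow> nat \<Rightarrow> (nat \<Rightarrow> int) \<Rightarrow> int \<Rightarrow> real" where
  "sample_ind S m z x = (\<Sum>i<m. ind S (x + z i)) / m"

lemma periodic_sample_ind: "periodic (sample_ind S m z)"
  unfolding periodic_def sample_ind_def
  by (auto intro!: sum.cong arg_cong2[where f = "(/)"] ind_cong simp: mod_add_left_eq)

lemma sum_excess_sample_le:
  assumes B: "finite B" "B \<noteq> {}" and \<eta>: "0 < \<eta>" "\<eta> \<le> 1" and m: "2 \<le> \<eta> * m"
  shows "(\<Sum>z\<in>{..<m} \<rightarrow>\<^sub>E B. excess \<eta> (\<lambda>x. sample_ind S m z x - avg_ind S B x))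
      \<le> N * (2 * exp (- (\<eta>\<^sup>2 * m / 4)) * card B ^ m)"
proof -
  have m0: "m > 0" using m by (cases m) auto
  have c0: "real (card B) > 0" using B by (simp add: card_gt_0_iff)
  have eq: "sample_ind S m z x - avg_ind S B x = (\<Sum>i<m. ind S (x + z i) - avg_ind S B x) / m" for z x
    using m0 by (simp add: sample_ind_def sum_subtractf field_simps)
  have "(\<Sum>z\<in>{..<m} \<rightarrow>\<^sub>E B. excess \<eta> (\<lambda>x. sample_ind S m z x - avg_ind S B x))
     = (\<Sum>x\<in>{0..<int N}. \<Sum>z\<in>{..<m} \<rightarrow>\<^sub>E B. max 0 (\<bar>(\<Sum>i<m. ind S (x + z i) - avg_ind S B x) / m\<bar> - \<eta>))"
    unfolding excess_def by (subst sum.swap) (simp add: eq)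
  also have "\<dots> \<le> (\<Sum>x\<in>{0..<int N}. 2 * exp (- (\<eta>\<^sup>2 * m / 4)) * card B ^ m)"
  proof (intro sum_mono)
    fix x
    show "(\<Sum>z\<in>{..<m} \<rightarrow>\<^sub>E B. max 0 (\<bar>(\<Sum>i<m. ind S (x + z i) - avg_ind S B x) / m\<bar> - \<eta>))
      \<le> 2 * exp (- (\<eta>\<^sup>2 * m / 4)) * card B ^ m"
    proof (rule sum_tuples_deviation_le[where Y = "\<lambda>b. ind S (x + b) - avg_ind S B x"])
      show "\<bar>ind S (x + b) - avg_ind S B x\<bar> \<le> 1" for b
        using ind_range[of S "x+b"] avg_ind_range[of S B x] by linarith
      show "(\<Sum>b\<in>B. ind S (x + b) - avg_ind S B x) = 0"
        using c0 by (simp add: sum_subtractf) (simp add: avg_ind_def)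
    qed (use B \<eta> m in auto)
  qed
  finally show ?thesis by simp
qed

text \<open>Markov's inequality: the second condition on M makes the mean excess over all tuples at
  most M / 2.\<close>

lemma half_tuples_good:
  assumes B: "finite B" "B \<noteq> {}" and \<eta>: "0 < \<eta>" "\<eta> \<le> 1" and m: "2 \<le> \<eta> * m"
    and M: "0 < M" "4 * N * exp (- (\<eta>\<^sup>2 * m / 4)) \<le> M"
  shows "real (card B) ^ m \<le>
    2 * card {z \<in> {..<m} \<rightarrow>\<^sub>E B. excess \<eta> (\<lambda>x. sample_ind S m z x - avg_ind S B x) \<le> M}"
proof -
  define P where "P = {..<m} \<rightarrow>\<^sub>E B"
  let ?E = "\<lambda>z. excess \<eta> (\<lambda>x. sample_ind S m z x - avg_ind S B x)"
  have fin: "finite P" unfolding P_def using B by (intro finite_PiE) auto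
  have card: "card P = card B ^ m" by (simp add: P_def card_PiE)
  define bad where "bad = {z \<in> P. ?E z > M}"
  define good where "good = {z \<in> P. ?E z \<le> M}"
  have E0: "?E z \<ge> 0" for z by (auto simp: excess_def intro: sum_nonneg)
  have "M * card bad = (\<Sum>z\<in>bad. M)" by simp
  also have "\<dots> \<le> (\<Sum>z\<in>bad. ?E z)" by (rule sum_mono) (auto simp: bad_def)
  also have "\<dots> \<le> (\<Sum>z\<in>P. ?E z)" using fin E0 by (intro sum_mono2) (auto simp: bad_def)
  also have "\<dots> \<le> N * (2 * exp (- (\<eta>\<^sup>2 * m / 4)) * card B ^ m)"
    unfolding P_def by (rule sum_excess_sample_le) (use B \<eta> m in auto)
  also have "\<dots> = (4 * N * exp (- (\<eta>\<^sup>2 * m / 4))) * (card B ^ m / 2)" by simp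
  also have "\<dots> \<le> M * (card B ^ m / 2)" using M by (intro mult_right_mono) auto
  finally have "2 * real (card bad) \<le> card B ^ m" using M by simp
  moreover have "card bad + card good = card P"
  proof -
    have "P = bad \<union> good" by (auto simp: bad_def good_def)
    moreover have "finite bad" "finite good" "bad \<inter> good = {}"
      using fin by (auto simp: bad_def good_def)
    ultimately show ?thesis by (metis card_Un_disjoint)
  qed
  then have "real (card bad) + real (card good) = card B ^ m"
    unfolding card by (metis of_nat_add)
  ultimately show ?thesis unfolding P_def[symmetric] good_def[symmetric] of_nat_power by linarith
qed

text \<open>Moving the sample points by t amounts to moving the argument by t. For t in A this
  carries good samples from B to samples from A + B.\<close>

lemma sample_ind_shift:
  "sample_ind S m (\<lambda>i\<in>{..<m}. (t + b i) mod int N) x = sample_ind S m b (x + t)"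
  unfolding sample_ind_def
  by (intro arg_cong2[where f = "(/)"] sum.cong refl ind_cong)
    (simp add: mod_add_right_eq add.assoc)

text \<open>The Croot-Sisask argument. For each t in A, translating the good tuples of B by t gives
  at least |B|^m / 2 tuples of S that approximate h shifted by t. There are at most (K |B|)^m tuples
  of S, so a single tuple z serves at least |A| / (2 K^m) of the t. Any two of the corresponding
  shifts of h are close to the same sample function, hence to each other.\<close>

lemma exists_almost_periods:
  fixes K \<eta> M :: real
  assumes A: "finite A" "A \<noteq> {}" and B: "B \<subseteq> {0..<int N}" "B \<noteq> {}" and S: "finite S"
    and AB: "\<And>a b. a \<in> A \<Longrightarrow> b \<in> B \<Longrightarrow> (a + b) mod int N \<in> S"
    and K: "card S \<le> K * card B"
    and \<eta>: "0 < \<eta>" "\<eta> \<le> 1" and m: "2 \<le> \<eta> * m"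
    and M: "0 < M" "4 * N * exp (- (\<eta>\<^sup>2 * m / 4)) \<le> M"
  obtains T where "T \<subseteq> A" "card A \<le> 2 * K ^ m * card T"
    "\<And>t t'. t \<in> T \<Longrightarrow> t' \<in> T \<Longrightarrow>
       excess (2 * \<eta>) (\<lambda>x. avg_ind S B (x + t) - avg_ind S B (x + t')) \<le> 2 * M"
proof -
  have finB: "finite B" using B finite_subset by blast
  define Z where "Z = {..<m} \<rightarrow>\<^sub>E S"
  have finZ: "finite Z" unfolding Z_def using S by (intro finite_PiE) auto
  define R where "R t z \<longleftrightarrow> excess \<eta> (\<lambda>x. sample_ind S m z x - avg_ind S B (x + t)) \<le> M" for t z
  have many: "real (card B) ^ m \<le> 2 * card {z \<in> Z. R t z}" if t: "t \<in> A" for t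
  proof -
    let ?\<phi> = "\<lambda>b. \<lambda>i\<in>{..<m}. (t + b i) mod int N"
    define D where "D = {b \<in> {..<m} \<rightarrow>\<^sub>E B. excess \<eta> (\<lambda>x. sample_ind S m b x - avg_ind S B x) \<le> M}"
    have "inj_on ?\<phi> D"
    proof (rule inj_onI)
      fix b b' assume bb: "b \<in> D" "b' \<in> D" and eq: "?\<phi> b = ?\<phi> b'"
      have "b i = b' i" if i: "i \<in> {..<m}" for i
      proof -
        have "(t + b i) mod int N = (t + b' i) mod int N"
          using fun_cong[OF eq, of i] i by simp
        then have "int N dvd b i - b' i"
          by (simp add: mod_eq_dvd_iff)
        moreover have "b i \<in> {0..<int N}" "b' i \<in> {0..<int N}"
          using bb i B by (auto simp: D_def)
        ultimately show ?thesis
          using zdvd_imp_le[of "int N" "\<bar>b i - b' i\<bar>"] by (cases "b i = b' i") auto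
      qed
      moreover have "b \<in> extensional {..<m}" "b' \<in> extensional {..<m}"
        using bb by (auto simp: D_def PiE_def)
      ultimately show "b = b'"
        by (metis extensionalityI)
    qed
    moreover have "?\<phi> ` D \<subseteq> {z \<in> Z. R t z}"
    proof (rule image_subsetI)
      fix b assume b: "b \<in> D"
      have "?\<phi> b \<in> Z" unfolding Z_def using b t AB by (auto simp: D_def)
      moreover have "R t (?\<phi> b)"
      proof -
        have "periodic (\<lambda>x. sample_ind S m b x - avg_ind S B x)"
          using periodic_sample_ind periodic_avg_ind by (simp add: periodic_def)
        then have "excess \<eta> (\<lambda>x. sample_ind S m b (x + t) - avg_ind S B (x + t))
          = excess \<eta> (\<lambda>x. sample_ind S m b x - avg_ind S B x)"
          by (rule excess_shift)
        then show ?thesis using b unfolding R_def sample_ind_shift by (simp add: D_def)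
      qed
      ultimately show "?\<phi> b \<in> {z \<in> Z. R t z}" by simp
    qed
    ultimately have "card D \<le> card {z \<in> Z. R t z}"
      using finZ by (intro card_inj_on_le) auto
    moreover have "real (card B) ^ m \<le> 2 * card D"
      unfolding D_def by (rule half_tuples_good) (use finB B \<eta> m M in auto)
    ultimately show ?thesis by linarith
  qed
  have cB: "real (card B) > 0" using finB B by (simp add: card_gt_0_iff)
  have cA: "real (card A) > 0" using A by (simp add: card_gt_0_iff)
  have swap: "(\<Sum>z\<in>Z. card {t \<in> A. R t z}) = (\<Sum>t\<in>A. card {z \<in> Z. R t z})"
  proof -
    have "(\<Sum>z\<in>Z. card {t \<in> A. R t z}) = (\<Sum>z\<in>Z. \<Sum>t\<in>A. of_bool (R t z))"
      using A by (intro sum.cong refl) (simp add: sum.If_cases of_bool_def Int_def)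
    also have "\<dots> = (\<Sum>t\<in>A. \<Sum>z\<in>Z. of_bool (R t z))" by (rule sum.swap)
    also have "\<dots> = (\<Sum>t\<in>A. card {z \<in> Z. R t z})"
      using finZ by (intro sum.cong refl) (simp add: sum.If_cases of_bool_def Int_def)
    finally show ?thesis .
  qed
  have low: "card A * card B ^ m \<le> 2 * (\<Sum>z\<in>Z. real (card {t \<in> A. R t z}))"
  proof -
    have "card A * real (card B) ^ m = (\<Sum>t\<in>A. real (card B) ^ m)" by simp
    also have "\<dots> \<le> (\<Sum>t\<in>A. 2 * real (card {z \<in> Z. R t z}))" by (rule sum_mono) (use many in force)
    also have "\<dots> = 2 * real (\<Sum>t\<in>A. card {z \<in> Z. R t z})" by (simp add: sum_distrib_left)
    finally show ?thesis unfolding swap[symmetric] by simp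
  qed
  \<comment> \<open>Pigeonhole on the double count \<open>low\<close>: if every z had fewer than |A|
    / (2 K^m) partners t, the total would fall below |A| |B|^m / 2.\<close>
  have "\<exists>z\<in>Z. card A \<le> 2 * K ^ m * card {t \<in> A. R t z}"
  proof (rule ccontr)
    assume "\<not> ?thesis"
    then have less: "2 * K ^ m * card {t \<in> A. R t z} < card A" if "z \<in> Z" for z
      using that by force
    have "0 < card A * real (card B) ^ m" using cA cB by simp
    then have "Z \<noteq> {}" using low by force
    have K0: "K > 0"
    proof -
      obtain a b where "a \<in> A" "b \<in> B" using A B by auto
      then have "card S > 0" using AB S by (auto simp: card_gt_0_iff)
      then have "0 < K * card B" using K by linarith
      then show ?thesis using cB by (simp add: zero_less_mult_iff)
    qed
    have "K ^ m * (card A * card B ^ m) \<le> K ^ m * (2 * (\<Sum>z\<in>Z. real (card {t \<in> A. R t z})))"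
      using low K0 by (intro mult_left_mono) auto
    also have "\<dots> = (\<Sum>z\<in>Z. 2 * K ^ m * card {t \<in> A. R t z})"
      by (simp add: sum_distrib_left mult_ac)
    also have "\<dots> < (\<Sum>z\<in>Z. card A)"
      unfolding of_nat_sum by (rule sum_strict_mono) (use finZ \<open>Z \<noteq> {}\<close> less in auto)
    also have "\<dots> = card S ^ m * card A"
      by (simp add: Z_def card_PiE)
    also have "\<dots> \<le> (K * card B) ^ m * card A"
      using K by (simp add: mult_right_mono power_mono)
    finally show False by (simp add: power_mult_distrib mult_ac)
  qed
  then obtain z where z: "z \<in> Z" "card A \<le> 2 * K ^ m * card {t \<in> A. R t z}" by blast
  show ?thesis
  proof (rule that[of "{t \<in> A. R t z}"])
    fix t t' assume t: "t \<in> {t \<in> A. R t z}" "t' \<in> {t \<in> A. R t z}"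
    have "excess (\<eta> + \<eta>) (\<lambda>x. (avg_ind S B (x + t) - sample_ind S m z x)
             + (sample_ind S m z x - avg_ind S B (x + t'))) \<le> M + M"
    proof (rule order.trans[OF excess_add add_mono])
      show "excess \<eta> (\<lambda>x. avg_ind S B (x + t) - sample_ind S m z x) \<le> M"
        using t by (subst excess_minus_commute) (simp add: R_def)
      show "excess \<eta> (\<lambda>x. sample_ind S m z x - avg_ind S B (x + t')) \<le> M"
        using t by (simp add: R_def)
    qed
    then show "excess (2 * \<eta>) (\<lambda>x. avg_ind S B (x + t) - avg_ind S B (x + t')) \<le> 2 * M"
      by simp
  qed (use z in auto)
qed

section \<open>Fourier analysis\<close>

definition e :: "int \<Rightarrow> complex" where
  "e x = cis (2 * pi * (of_int x / N))"

lemma e_0 [simp]: "e 0 = 1"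
  by (simp add: e_def)

lemma e_add: "e (x + y) = e x * e y"
  by (simp add: e_def cis_mult distrib_left add_divide_distrib)

lemma e_minus: "e (- x) = cnj (e x)"
  by (simp add: e_def cis_cnj)

lemma e_diff: "e (x - y) = e x * cnj (e y)"
  using e_add[of x "- y"] by (simp add: e_minus)

lemma norm_e [simp]: "norm (e x) = 1"
  by (simp add: e_def)

lemma e_eq_1_iff: "e x = 1 \<longleftrightarrow> int N dvd x"
proof -
  have "e x = 1 \<longleftrightarrow> (\<exists>n. of_int x = (of_int (int N * n) :: real))"
    using N_pos by (simp add: e_def cis_eq_1_iff field_simps)
  also have "\<dots> \<longleftrightarrow> int N dvd x"
    unfolding of_int_eq_iff dvd_def ..
  finally show ?thesis .
qed

lemma e_cong: "int N dvd x - y \<Longrightarrow> e x = e y"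
  using e_add[of "x - y" y] by (simp flip: e_eq_1_iff)

lemma e_mult_mod: "e (r * (x mod int N)) = e (r * x)"
  by (intro e_cong) (metis dvd_mult mod_eq_dvd_iff mod_mod_trivial right_diff_distrib')

lemma sum_e: "(\<Sum>x\<in>{0..<int N}. e (r * x)) = (if int N dvd r then of_nat N else 0)"
proof (cases "int N dvd r")
  case True
  then have "e (r * x) = 1" for x by (simp add: e_eq_1_iff)
  then show ?thesis using True by simp
next
  case False
  \<comment> \<open>Replacing x by x + 1 leaves the sum unchanged but multiplies it by
    \<open>e r\<close>, which is not 1, so the sum vanishes.\<close>
  have "periodic (\<lambda>x. e (r * x))"
    by (simp add: periodic_def e_mult_mod)
  then have "(\<Sum>x\<in>{0..<int N}. e (r * (x + 1))) = (\<Sum>x\<in>{0..<int N}. e (r * x))"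
    by (rule sum_shift)
  then have "e r * (\<Sum>x\<in>{0..<int N}. e (r * x)) = (\<Sum>x\<in>{0..<int N}. e (r * x))"
    by (simp add: distrib_left e_add sum_distrib_left mult.commute)
  moreover have "e r \<noteq> 1" using False by (simp add: e_eq_1_iff)
  ultimately show ?thesis using False by simp
qed

text \<open>The unnormalised Fourier transform of the indicator of X, with positive sign in the
  exponent; inversion therefore uses its conjugate.\<close>

definition esum :: "int set \<Rightarrow> int \<Rightarrow> complex" where
  "esum X r = (\<Sum>x\<in>X. e (r * x))"

lemma dvd_diff_iff_eq:
  assumes "x \<in> {0..<int N}" "y \<in> {0..<int N}"
  shows "int N dvd x - y \<longleftrightarrow> x = y"
  using assms by (metis atLeastLessThan_iff mod_eq_dvd_iff mod_pos_pos_trivial)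

lemma parseval:
  assumes "X \<subseteq> {0..<int N}"
  shows "(\<Sum>r\<in>{0..<int N}. (norm (esum X r))\<^sup>2) = N * card X"
proof -
  have fin: "finite X" using assms finite_subset by blast
  have "complex_of_real (\<Sum>r\<in>{0..<int N}. (norm (esum X r))\<^sup>2)
      = (\<Sum>r\<in>{0..<int N}. esum X r * cnj (esum X r))"
    unfolding of_real_sum complex_norm_square[symmetric] by simp
  also have "\<dots> = (\<Sum>r\<in>{0..<int N}. \<Sum>x\<in>X. \<Sum>y\<in>X. e ((x - y) * r))"
    by (simp add: esum_def sum_product e_diff right_diff_distrib' mult.commute[of "_ - _"])
  also have "\<dots> = (\<Sum>x\<in>X. \<Sum>y\<in>X. \<Sum>r\<in>{0..<int N}. e ((x - y) * r))"
    by (subst sum.swap, intro sum.cong refl sum.swap)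
  also have "\<dots> = (\<Sum>x\<in>X. \<Sum>y\<in>X. if x = y then of_nat N else 0)"
    unfolding sum_e using assms by (intro sum.cong refl) (simp add: dvd_diff_iff_eq subset_iff)
  also have "\<dots> = complex_of_real (N * card X)"
    using fin by simp
  finally show ?thesis unfolding of_real_eq_iff .
qed

lemma ind_inversion:
  assumes "S \<subseteq> {0..<int N}"
  shows "complex_of_real (ind S y) = (\<Sum>r\<in>{0..<int N}. cnj (esum S r) * e (r * y)) / N"
proof -
  have fin: "finite S" using assms finite_subset by blast
  have "(\<Sum>r\<in>{0..<int N}. cnj (esum S r) * e (r * y)) = (\<Sum>r\<in>{0..<int N}. \<Sum>x\<in>S. e ((y - x) * r))"
    by (simp add: esum_def sum_distrib_left e_diff right_diff_distrib' mult.commute[of "_ - _"]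
        mult.commute[of "sum _ _" "e _"])
  also have "\<dots> = (\<Sum>x\<in>S. \<Sum>r\<in>{0..<int N}. e ((y - x) * r))"
    by (rule sum.swap)
  also have "\<dots> = (\<Sum>x\<in>S. if x = y mod int N then of_nat N else 0)"
    unfolding sum_e
  proof (intro sum.cong refl)
    fix x assume "x \<in> S"
    then have "x mod int N = x" using assms by auto
    then show "(if int N dvd y - x then of_nat N else 0) = (if x = y mod int N then of_nat N else (0::complex))"
      by (auto simp flip: mod_eq_dvd_iff)
  qed
  also have "\<dots> = N * complex_of_real (ind S y)"
    using fin by (simp add: ind_def)
  finally show ?thesis using N_pos by simp
qed

text \<open>The average of \<open>avg_ind S B\<close> over sums of k differences from T - T, written
  on the Fourier side: each averaging multiplies frequency r by (|esum T r| / |T|)^2. The next two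
  lemmas justify this reading.\<close>

definition smoothed :: "int set \<Rightarrow> int set \<Rightarrow> int set \<Rightarrow> nat \<Rightarrow> int \<Rightarrow> complex" where
  "smoothed S B T k y = (\<Sum>r\<in>{0..<int N}.
     cnj (esum S r) * esum B r * of_real ((norm (esum T r) / card T) ^ (2 * k)) * e (r * y)) / (N * card B)"

lemma smoothed_0:
  assumes "S \<subseteq> {0..<int N}"
  shows "smoothed S B T 0 y = of_real (avg_ind S B y)"
proof -
  have "complex_of_real (avg_ind S B y)
      = (\<Sum>b\<in>B. (\<Sum>r\<in>{0..<int N}. cnj (esum S r) * e (r * (y + b))) / N) / card B"
    by (simp add: avg_ind_def ind_inversion[OF assms])
  also have "\<dots> = (\<Sum>r\<in>{0..<int N}. \<Sum>b\<in>B. cnj (esum S r) * e (r * (y + b))) / (N * card B)"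
    by (subst sum.swap) (simp flip: sum_divide_distrib)
  also have "\<dots> = smoothed S B T 0 y"
    by (simp add: smoothed_def esum_def[of B] e_add distrib_left sum_distrib_left sum_distrib_right mult_ac)
  finally show ?thesis ..
qed

lemma smoothed_Suc:
  "smoothed S B T (Suc k) y =
     (\<Sum>(t, t')\<in>T \<times> T. smoothed S B T k (y + (t - t'))) /\<^sub>R card (T \<times> T)"
proof -
  define c where "c r = cnj (esum S r) * esum B r * of_real ((norm (esum T r) / card T) ^ (2 * k))" for r
  \<comment> \<open>The double sum is \<open>esum T r\<close> times its conjugate; divided by |T|^2
    it is the multiplier gained in one averaging.\<close>
  have sq: "(\<Sum>p\<in>T \<times> T. e (r * (fst p - snd p))) = of_real ((norm (esum T r))\<^sup>2)" for r
    unfolding complex_norm_square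
    by (simp add: esum_def sum_product sum.cartesian_product case_prod_beta right_diff_distrib e_diff)
  have "(\<Sum>(t, t')\<in>T \<times> T. smoothed S B T k (y + (t - t')))
    = (\<Sum>p\<in>T \<times> T. (\<Sum>r\<in>{0..<int N}. c r * e (r * y) * e (r * (fst p - snd p))) / (N * card B))"
    unfolding smoothed_def c_def
    by (simp add: case_prod_beta distrib_left e_add mult.assoc)
  also have "\<dots> = (\<Sum>r\<in>{0..<int N}. c r * e (r * y) * (\<Sum>p\<in>T \<times> T. e (r * (fst p - snd p)))) / (N * card B)"
    unfolding sum_divide_distrib[symmetric] sum_distrib_left by (subst sum.swap) (rule refl)
  also have "\<dots> /\<^sub>R card (T \<times> T) = (\<Sum>r\<in>{0..<int N}. c r * e (r * y) * of_real ((norm (esum T r) / card T)\<^sup>2)) / (N * card B)"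
    unfolding sq
    by (simp add: scaleR_conv_of_real sum_divide_distrib card_cartesian_product power2_eq_square
        sum_distrib_left divide_simps)
  also have "\<dots> = smoothed S B T (Suc k) y"
    by (simp add: smoothed_def c_def power_add power2_eq_square mult_ac)
  finally show ?thesis ..
qed

lemma periodic_smoothed: "periodic (smoothed S B T k)"
  by (simp add: periodic_def smoothed_def e_mult_mod)

text \<open>Induction on k. The error of step k + 1 is the average, over pairs t, t' from T, of the
  error of step k shifted by t - t' plus the change of h under that shift. The first has excess at
  most k M at threshold k c, the second at most M at threshold c.\<close>

lemma excess_smoothed:
  assumes S: "S \<subseteq> {0..<int N}" and T: "finite T" "T \<noteq> {}"
    and per: "\<And>t t'. t \<in> T \<Longrightarrow> t' \<in> T \<Longrightarrow>
       excess c (\<lambda>x. avg_ind S B (x + t) - avg_ind S B (x + t')) \<le> M"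
  shows "excess (k * c) (\<lambda>x. smoothed S B T k x - of_real (avg_ind S B x)) \<le> k * M"
proof (induction k)
  case 0
  show ?case by (simp add: smoothed_0[OF S] excess_def)
next
  case (Suc k)
  let ?h = "\<lambda>x. complex_of_real (avg_ind S B x)"
  let ?u = "\<lambda>p. fst p - snd p"
  define I where "I = T \<times> T"
  have I: "finite I" "I \<noteq> {}" using T by (auto simp: I_def)
  then have c0: "real (card I) \<noteq> 0" by simp
  have le: "excess (k * c + c) (\<lambda>x. smoothed S B T k (x + ?u p) - ?h x) \<le> k * M + M"
    if p: "p \<in> I" for p
  proof -
    have "excess (k * c + c) (\<lambda>x. (smoothed S B T k (x + ?u p) - ?h (x + ?u p)) + (?h (x + ?u p) - ?h x))
      \<le> k * M + M"
    proof (rule order.trans[OF excess_add add_mono])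
      have "periodic (\<lambda>x. smoothed S B T k x - ?h x)"
        using periodic_smoothed periodic_avg_ind by (simp add: periodic_def)
      from excess_shift[OF this]
      show "excess (k * c) (\<lambda>x. smoothed S B T k (x + ?u p) - ?h (x + ?u p)) \<le> k * M"
        using Suc.IH by simp
      \<comment> \<open>Moving the argument by - t' turns the comparison of the shifts t and t' in
        \<open>per\<close> into one between the shift t - t' and no shift.\<close>
      have "periodic (\<lambda>x. avg_ind S B (x + fst p) - avg_ind S B (x + snd p))"
        using periodic_shift[OF periodic_avg_ind] by (simp add: periodic_def)
      from excess_shift[OF this, of c "- snd p"]
      have "excess c (\<lambda>x. avg_ind S B (x + ?u p) - avg_ind S B x) \<le> M"
        using per[of "fst p" "snd p"] p by (auto simp: I_def algebra_simps)
      then show "excess c (\<lambda>x. ?h (x + ?u p) - ?h x) \<le> M"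
        by (simp add: excess_def flip: of_real_diff)
    qed
    then show ?thesis by simp
  qed
  have "excess (k * c + c) (\<lambda>x. (\<Sum>p\<in>I. smoothed S B T k (x + ?u p) - ?h x) /\<^sub>R card I) \<le> k * M + M"
    by (rule excess_average[OF I le])
  moreover have "(\<Sum>p\<in>I. smoothed S B T k (x + ?u p) - ?h x) /\<^sub>R card I
      = smoothed S B T (Suc k) x - ?h x" for x
    unfolding smoothed_Suc I_def[symmetric] case_prod_beta using c0
    by (simp add: sum_subtractf scaleR_conv_of_real field_simps)
  ultimately have "excess (k * c + c) (\<lambda>x. smoothed S B T (Suc k) x - ?h x) \<le> k * M + M"
    by simp
  then show ?case by (simp add: distrib_right add.commute)
qed

lemma e_sum: "e (\<Sum>l\<in>L. f l) = (\<Prod>l\<in>L. e (f l))"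
  by (induction L rule: infinite_finite_induct) (auto simp: e_add)

text \<open>Subtracting from y / N its nearest integer does not change \<open>e y\<close>, and a
  chord is no longer than its arc.\<close>

lemma norm_e_diff_1_le: "norm (e y - 1) \<le> 2 * pi * circle_norm (e y)"
proof -
  let ?\<theta> = "of_int y / real N"
  have "(\<int> :: real set) \<noteq> {}" using Ints_0 by blast
  then obtain n where n: "n \<in> \<int>" "infdist ?\<theta> \<int> = dist ?\<theta> n"
    using infdist_attains_inf[OF closed_Ints, of ?\<theta>] by blast
  then obtain k :: int where k: "n = of_int k" by (auto elim: Ints_cases)
  have "cis (2 * pi * (?\<theta> - n)) = e y * cnj (cis (2 * pi * n))"
    by (simp add: e_def cis_cnj cis_mult right_diff_distrib)
  also have "cis (2 * pi * n) = 1"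
    unfolding cis_eq_1_iff k by (auto intro!: exI[of _ k])
  finally have "norm (e y - 1) = norm (cis (2 * pi * (?\<theta> - n)) - 1)" by simp
  also have "\<dots> \<le> \<bar>2 * pi * (?\<theta> - n)\<bar>" by (rule norm_cis_diff_1_le)
  also have "\<dots> = 2 * pi * circle_norm (e y)"
    unfolding e_def circle_norm_cis n(2) by (simp add: abs_mult dist_real_def)
  finally show ?thesis .
qed

section \<open>Dissociated sets and the large spectrum\<close>

text \<open>The coefficient functions are extensional because they index the expansion of a product
  over L of three-term sums, where the zero combination has to occur exactly once.\<close>

definition dissociated :: "int set \<Rightarrow> bool" where
  "dissociated L \<longleftrightarrow> (\<forall>\<epsilon> \<in> L \<rightarrow>\<^sub>E {-1, 0, 1}. int N dvd (\<Sum>l\<in>L. \<epsilon> l * l) \<longrightarrow> (\<forall>l\<in>L. \<epsilon> l = 0))"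

text \<open>Each factor has only the frequencies - l, 0 and l. In the expanded product
  dissociativity makes the zero combination the only one with frequency 0 modulo N, and all other
  terms sum to 0 over the group.\<close>

lemma sum_riesz_product:
  fixes w s :: real and c :: "int \<Rightarrow> complex"
  assumes L: "finite L" "dissociated L"
  shows "(\<Sum>x\<in>{0..<int N}. \<Prod>l\<in>L. w + s * Re (c l * e (l * x))) = N * w ^ card L"
proof -
  define a where "a l j = (if j = 0 then of_real w else if j = 1 then s * c l / 2 else s * cnj (c l) / 2)"
    for l and j :: int
  let ?E = "L \<rightarrow>\<^sub>E {-1, 0, 1 :: int}"
  have fact: "complex_of_real (w + s * Re (c l * e (l * x))) = (\<Sum>j\<in>{-1, 0, 1}. a l j * e (j * l * x))" for l x
  proof -
    have "complex_of_real (Re z) = (z + cnj z) / 2" for z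
      by (simp add: complex_add_cnj)
    then have "complex_of_real (Re (c l * e (l * x))) = (c l * e (l * x) + cnj (c l * e (l * x))) / 2" .
    then show ?thesis
      unfolding of_real_add of_real_mult[of s]
      by (simp add: a_def e_minus field_simps)
  qed
  have "complex_of_real (\<Sum>x\<in>{0..<int N}. \<Prod>l\<in>L. w + s * Re (c l * e (l * x)))
      = (\<Sum>x\<in>{0..<int N}. \<Prod>l\<in>L. \<Sum>j\<in>{-1, 0, 1}. a l j * e (j * l * x))"
    unfolding of_real_sum of_real_prod fact ..
  also have "\<dots> = (\<Sum>x\<in>{0..<int N}. \<Sum>\<epsilon>\<in>?E. \<Prod>l\<in>L. a l (\<epsilon> l) * e (\<epsilon> l * l * x))"
    using L by (subst prod_sum_PiE) auto
  also have "\<dots> = (\<Sum>x\<in>{0..<int N}. \<Sum>\<epsilon>\<in>?E. (\<Prod>l\<in>L. a l (\<epsilon> l)) * e ((\<Sum>l\<in>L. \<epsilon> l * l) * x))"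
    by (simp add: prod.distrib sum_distrib_right e_sum)
  also have "\<dots> = (\<Sum>\<epsilon>\<in>?E. (\<Prod>l\<in>L. a l (\<epsilon> l)) * (\<Sum>x\<in>{0..<int N}. e ((\<Sum>l\<in>L. \<epsilon> l * l) * x)))"
    by (subst sum.swap) (simp add: sum_distrib_left)
  also have "\<dots> = (\<Sum>\<epsilon>\<in>?E. if \<epsilon> = (\<lambda>l\<in>L. 0) then of_real w ^ card L * of_nat N else 0)"
  proof (intro sum.cong refl)
    fix \<epsilon> assume \<epsilon>: "\<epsilon> \<in> ?E"
    show "(\<Prod>l\<in>L. a l (\<epsilon> l)) * (\<Sum>x\<in>{0..<int N}. e ((\<Sum>l\<in>L. \<epsilon> l * l) * x))
        = (if \<epsilon> = (\<lambda>l\<in>L. 0) then of_real w ^ card L * of_nat N else 0)"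
    proof (cases "\<epsilon> = (\<lambda>l\<in>L. 0)")
      case True
      then show ?thesis by (simp add: sum_e a_def)
    next
      case False
      then have "\<exists>l\<in>L. \<epsilon> l \<noteq> 0"
        using \<epsilon> by (metis PiE_restrict restrict_ext)
      then have "\<not> int N dvd (\<Sum>l\<in>L. \<epsilon> l * l)"
        using L(2) \<epsilon> by (auto simp: dissociated_def)
      then show ?thesis using False by (simp add: sum_e)
    qed
  qed
  also have "\<dots> = complex_of_real (N * w ^ card L)"
  proof -
    have "finite ?E" "(\<lambda>l\<in>L. 0) \<in> ?E" using L by (auto intro: finite_PiE)
    then show ?thesis by simp
  qed
  finally show ?thesis unfolding of_real_eq_iff .
qed

text \<open>Rudin's inequality is replaced by comparing, on \<open>T\<close> and on the whole group, the exponential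
  of the real part of a trigonometric polynomial with a Riesz product.\<close>

lemma card_dissociated_le:
  assumes T: "T \<subseteq> {0..<int N}" "T \<noteq> {}" and L: "finite L" "dissociated L"
    and large: "\<And>l. l \<in> L \<Longrightarrow> card T \<le> 2 * norm (esum T l)"
  shows "card L \<le> 16 * ln (N / card T)"
proof -
  have finT: "finite T" using T finite_subset by blast
  have T0: "real (card T) > 0" using finT T by (simp add: card_gt_0_iff)
  \<comment> \<open>The phase that turns \<open>esum T l\<close> into its modulus, so that each l
    adds at least |T| / 2 to the sum of f over T.\<close>
  define c where "c l = cnj (sgn (esum T l))" for l
  have c1: "norm (c l) \<le> 1" for l by (simp add: c_def norm_sgn)
  define f where "f x = (\<Sum>l\<in>L. Re (c l * e (l * x)))" for x
  have sumf: "card L * card T \<le> 2 * (\<Sum>t\<in>T. f t)"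
  proof -
    have "(\<Sum>t\<in>T. f t) = (\<Sum>l\<in>L. Re (c l * esum T l))"
      unfolding f_def esum_def sum_distrib_left Re_sum by (rule sum.swap)
    also have "\<dots> = (\<Sum>l\<in>L. norm (esum T l))"
    proof (intro sum.cong refl)
      fix l
      show "Re (c l * esum T l) = norm (esum T l)"
      proof (cases "esum T l = 0")
        case False
        have "c l * esum T l = (esum T l * cnj (esum T l)) / norm (esum T l)"
          by (simp add: c_def sgn_div_norm scaleR_conv_of_real divide_inverse mult_ac)
        also have "\<dots> = of_real (norm (esum T l))"
          using False unfolding complex_norm_square[symmetric] by (simp add: power2_eq_square)
        finally show ?thesis by simp
      qed simp
    qed
    also have "\<dots> \<ge> (\<Sum>l\<in>L. card T / 2)"
      using large by (intro sum_mono) (auto simp: field_simps)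
    finally show ?thesis by simp
  qed
  \<comment> \<open>By \<open>sumf\<close> the mean of f / 4 over T is at least q, and the tangent
    line of exp at q yields Jensen's inequality. If f is scaled by s, the gain here is s |L| / 2 and
    the loss in the Riesz product below is s^2 |L|; s = 1/4 maximises the difference, which is then
    |L| / 16.\<close>
  define q where "q = real (card L) / 8"
  have "card T * exp q \<le> (\<Sum>t\<in>T. exp (f t / 4))"
  proof -
    have "0 \<le> (\<Sum>t\<in>T. f t / 4 - q)"
      using sumf by (simp add: sum_subtractf q_def flip: sum_divide_distrib)
    then have "card T * exp q \<le> exp q * (card T + (\<Sum>t\<in>T. f t / 4 - q))"
      by (simp add: algebra_simps)
    also have "\<dots> = (\<Sum>t\<in>T. exp q * (1 + (f t / 4 - q)))"
      unfolding sum_distrib_left[symmetric] sum.distrib by simp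
    also have "\<dots> \<le> (\<Sum>t\<in>T. exp q * exp (f t / 4 - q))"
      by (intro sum_mono mult_left_mono exp_ge_add_one_self) auto
    also have "\<dots> = (\<Sum>t\<in>T. exp (f t / 4))"
      by (simp flip: exp_add)
    finally show ?thesis .
  qed
  also have "\<dots> \<le> (\<Sum>x\<in>{0..<int N}. exp (f x / 4))"
    using T by (intro sum_mono2) auto
  \<comment> \<open>Factor by factor, exp (r / 4) \<le> 1 + r / 4 + r^2 / 16 with |r| \<le> 1. The
    result is a Riesz product, whose sum over the group is known exactly.\<close>
  also have "\<dots> \<le> (\<Sum>x\<in>{0..<int N}. \<Prod>l\<in>L. 17/16 + 1/4 * Re (c l * e (l * x)))"
  proof (rule sum_mono)
    fix x
    have "exp (f x / 4) = (\<Prod>l\<in>L. exp (Re (c l * e (l * x)) / 4))"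
      using L by (simp add: f_def exp_sum sum_divide_distrib)
    also have "\<dots> \<le> (\<Prod>l\<in>L. 17/16 + 1/4 * Re (c l * e (l * x)))"
    proof (intro prod_mono conjI)
      fix l
      have r: "\<bar>Re (c l * e (l * x))\<bar> \<le> 1"
        using abs_Re_le_cmod[of "c l * e (l * x)"] c1[of l] by (simp add: norm_mult)
      then have "(Re (c l * e (l * x)))\<^sup>2 \<le> 1" by (simp add: abs_square_le_1)
      then show "exp (Re (c l * e (l * x)) / 4) \<le> 17/16 + 1/4 * Re (c l * e (l * x))"
        using exp_le_quadratic[of "Re (c l * e (l * x)) / 4"] r by (simp add: power_divide)
    qed auto
    finally show "exp (f x / 4) \<le> (\<Prod>l\<in>L. 17/16 + 1/4 * Re (c l * e (l * x)))" .
  qed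
  also have "\<dots> = N * (17/16) ^ card L" by (rule sum_riesz_product[OF L])
  also have "\<dots> \<le> N * exp (1/16) ^ card L"
    using exp_ge_add_one_self[of "1/16 :: real"] by (intro mult_left_mono power_mono) auto
  also have "\<dots> = N * exp (card L / 16)" by (simp flip: exp_of_nat_mult)
  finally have "card T * exp (card L / 8) \<le> N * exp (card L / 16)" by (simp add: q_def)
  moreover have "exp (card L / 8) = exp (card L / 16) * exp (card L / 16)"
    by (simp flip: exp_add)
  ultimately have "exp (card L / 16) \<le> N / card T"
    using T0 by (simp add: field_simps)
  then have "card L / 16 \<le> ln (N / card T)"
    by (smt (verit) exp_gt_zero ln_exp ln_mono)
  then show ?thesis by simp
qed

text \<open>\<open>e (r * w)\<close> is the product of the numbers
  \<open>e (\<epsilon> l * (l * w))\<close>, and for numbers of modulus 1 the distance of a product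
  to 1 is at most the sum of the distances.\<close>

lemma norm_e_span_le:
  fixes \<theta> :: real
  assumes \<epsilon>: "\<And>l. l \<in> L \<Longrightarrow> \<epsilon> l \<in> {-1, 0, 1}" and r: "int N dvd r - (\<Sum>l\<in>L. \<epsilon> l * l)"
    and le: "\<And>l. l \<in> L \<Longrightarrow> norm (e (l * w) - 1) \<le> \<theta>"
  shows "norm (e (r * w) - 1) \<le> card L * \<theta>"
proof -
  have "e (r * w) = e ((\<Sum>l\<in>L. \<epsilon> l * l) * w)"
    using r by (intro e_cong) (simp flip: left_diff_distrib')
  also have "\<dots> = (\<Prod>l\<in>L. e (\<epsilon> l * (l * w)))"
    by (simp add: sum_distrib_right e_sum mult.assoc)
  finally have "norm (e (r * w) - 1) = norm ((\<Prod>l\<in>L. e (\<epsilon> l * (l * w))) - (\<Prod>l\<in>L. 1))" by simp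
  also have "\<dots> \<le> (\<Sum>l\<in>L. norm (e (\<epsilon> l * (l * w)) - 1))"
    by (rule norm_prod_diff) auto
  also have "\<dots> \<le> (\<Sum>l\<in>L. \<theta>)"
  proof (rule sum_mono)
    fix l assume l: "l \<in> L"
    \<comment> \<open>The case \<epsilon> l = -1 is conjugation; the case \<epsilon> l = 0 needs
      \<theta> \<ge> 0, which \<open>le\<close> implies.\<close>
    have "norm (e (- (l * w)) - 1) = norm (cnj (e (l * w) - 1))" by (simp add: e_minus)
    also have "\<dots> = norm (e (l * w) - 1)" by (rule complex_mod_cnj)
    finally show "norm (e (\<epsilon> l * (l * w)) - 1) \<le> \<theta>"
      using \<epsilon>[OF l] le[OF l] norm_ge_zero[of "e (l * w) - 1"] by (auto simp del: norm_ge_zero)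
  qed
  finally show ?thesis by simp
qed

text \<open>L is a maximal dissociated subset of Q. Adding a further r from Q creates a nontrivial
  relation; it must involve r, since L is dissociated, and r has coefficient 1 or -1 there, so the
  relation can be solved for r.\<close>

lemma dissociated_spanning:
  assumes Q: "finite Q"
  obtains L where "L \<subseteq> Q" "dissociated L"
    "\<And>r. r \<in> Q \<Longrightarrow> \<exists>\<epsilon>. (\<forall>l\<in>L. \<epsilon> l \<in> {-1, 0, 1}) \<and> int N dvd r - (\<Sum>l\<in>L. \<epsilon> l * l)"
proof -
  let ?D = "{L. L \<subseteq> Q \<and> dissociated L}"
  have "\<exists>L\<in>?D. \<forall>M\<in>?D. L \<subseteq> M \<longrightarrow> L = M"
  proof (rule finite_has_maximal)
    show "finite ?D" using Q by simp
    have "{} \<in> ?D" by (simp add: dissociated_def)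
    then show "?D \<noteq> {}" by blast
  qed
  then obtain L where L: "L \<in> ?D" and max: "\<And>M. M \<in> ?D \<Longrightarrow> L \<subseteq> M \<Longrightarrow> L = M"
    by auto
  have finL: "finite L" using L Q finite_subset by blast
  show ?thesis
  proof (rule that)
    fix r assume r: "r \<in> Q"
    show "\<exists>\<epsilon>. (\<forall>l\<in>L. \<epsilon> l \<in> {-1, 0, 1}) \<and> int N dvd r - (\<Sum>l\<in>L. \<epsilon> l * l)"
    proof (cases "r \<in> L")
      case True
      have "(\<Sum>l\<in>L. of_bool (l = r) * l) = r" using True finL by simp
      then have "int N dvd r - (\<Sum>l\<in>L. of_bool (l = r) * l)" by simp
      then show ?thesis by (intro exI[of _ "\<lambda>l. of_bool (l = r)"] conjI) simp_all
    next
      case False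
      then have "insert r L \<notin> ?D" using max[of "insert r L"] by blast
      then obtain \<epsilon> where \<epsilon>: "\<epsilon> \<in> insert r L \<rightarrow>\<^sub>E {-1, 0, 1}"
        and dvd: "int N dvd (\<Sum>l\<in>insert r L. \<epsilon> l * l)" and nz: "\<not> (\<forall>l\<in>insert r L. \<epsilon> l = 0)"
        using L r by (auto simp: dissociated_def)
      have sum: "(\<Sum>l\<in>insert r L. \<epsilon> l * l) = \<epsilon> r * r + (\<Sum>l\<in>L. \<epsilon> l * l)"
        using finL False by simp
      have \<epsilon>L: "\<epsilon> l \<in> {-1, 0, 1}" if "l \<in> insert r L" for l using \<epsilon> that by (rule PiE_mem)
      have "\<epsilon> r \<noteq> 0"
      proof
        assume 0: "\<epsilon> r = 0"
        have eq: "(\<Sum>l\<in>L. restrict \<epsilon> L l * l) = (\<Sum>l\<in>L. \<epsilon> l * l)" by (intro sum.cong) auto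
        have "restrict \<epsilon> L \<in> L \<rightarrow>\<^sub>E {-1, 0, 1}"
          unfolding restrict_PiE_iff using \<epsilon>L by blast
        moreover have "int N dvd (\<Sum>l\<in>L. restrict \<epsilon> L l * l)"
          unfolding eq using dvd sum 0 by simp
        ultimately have "\<forall>l\<in>L. restrict \<epsilon> L l = 0"
          using L unfolding dissociated_def by blast
        then show False using nz 0 by auto
      qed
      then consider "\<epsilon> r = 1" | "\<epsilon> r = -1" using \<epsilon>L[of r] by auto
      then show ?thesis
      proof cases
        case 1
        have "int N dvd r - (\<Sum>l\<in>L. - \<epsilon> l * l)" using dvd 1 unfolding sum by (simp add: sum_negf)
        then show ?thesis using \<epsilon>L by (intro exI[of _ "\<lambda>l. - \<epsilon> l"]) fastforce
      next
        case 2
        have "int N dvd r - (\<Sum>l\<in>L. \<epsilon> l * l)"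
          using dvd 2 unfolding sum by (metis add.commute dvd_minus_iff minus_diff_eq mult_minus1 uminus_add_conv_diff)
        then show ?thesis using \<epsilon>L by blast
      qed
    qed
  qed (use L in auto)
qed

section \<open>From the large spectrum to the sumset\<close>

text \<open>Frequency r contributes at most D |esum S r| |esum B r|. By Cauchy-Schwarz and Parseval
  these products sum to at most D N |B| sqrt K, and N |B| is the normalisation in
  \<open>smoothed\<close>.\<close>

lemma norm_smoothed_diff_le:
  fixes K :: real
  assumes B: "B \<subseteq> {0..<int N}" "B \<noteq> {}" and S: "S \<subseteq> {0..<int N}" and K: "card S \<le> K * card B"
    and D: "\<And>r. r \<in> {0..<int N} \<Longrightarrow> (norm (esum T r) / card T) ^ (2 * k) * norm (e (r * w) - 1) \<le> D"
  shows "norm (smoothed S B T k (y + w) - smoothed S B T k y) \<le> D * sqrt K"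
proof -
  have finB: "finite B" using B finite_subset by blast
  have B0: "real (card B) > 0" using finB B by (simp add: card_gt_0_iff)
  have "0 \<in> {0..<int N}" using N_pos by simp
  from D[OF this] have D0: "D \<ge> 0" by simp
  define g where "g r = cnj (esum S r) * esum B r * of_real ((norm (esum T r) / card T) ^ (2 * k)) * e (r * y)" for r
  let ?G = "{0..<int N}"
  have eq: "smoothed S B T k (y + w) - smoothed S B T k y = (\<Sum>r\<in>?G. g r * (e (r * w) - 1)) / (N * card B)"
    unfolding smoothed_def g_def
    by (simp add: sum_subtractf algebra_simps e_add diff_divide_distrib)
  have "(\<Sum>r\<in>?G. norm (esum S r) * norm (esum B r))\<^sup>2
      \<le> (\<Sum>r\<in>?G. (norm (esum S r))\<^sup>2) * (\<Sum>r\<in>?G. (norm (esum B r))\<^sup>2)"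
    by (rule Cauchy_Schwarz_ineq_sum)
  also have "\<dots> = (N * card B) * (N * card S)"
    by (simp add: parseval[OF B(1)] parseval[OF S])
  also have "\<dots> \<le> (N * card B) * (N * (K * card B))"
    using K by (simp only: of_nat_mult) (intro mult_left_mono; simp)
  also have "\<dots> = (N * card B)\<^sup>2 * K" by (simp add: power2_eq_square)
  finally have cs: "(\<Sum>r\<in>?G. norm (esum S r) * norm (esum B r)) \<le> (N * card B) * sqrt K"
    using real_le_rsqrt by (fastforce simp: real_sqrt_mult)
  have "norm (\<Sum>r\<in>?G. g r * (e (r * w) - 1)) \<le> (\<Sum>r\<in>?G. norm (esum S r) * norm (esum B r) * D)"
  proof (rule sum_norm_le)
    fix r assume r: "r \<in> ?G"
    have "norm (g r * (e (r * w) - 1)) = norm (esum S r) * norm (esum B r) *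
        ((norm (esum T r) / card T) ^ (2 * k) * norm (e (r * w) - 1))"
      by (simp add: g_def norm_mult norm_power norm_divide)
    also have "\<dots> \<le> norm (esum S r) * norm (esum B r) * D"
      using D[OF r] by (intro mult_left_mono) auto
    finally show "norm (g r * (e (r * w) - 1)) \<le> norm (esum S r) * norm (esum B r) * D" .
  qed
  also have "\<dots> = D * (\<Sum>r\<in>?G. norm (esum S r) * norm (esum B r))"
    by (simp add: sum_distrib_left mult_ac)
  also have "\<dots> \<le> D * ((N * card B) * sqrt K)"
    using cs D0 by (rule mult_left_mono)
  finally have "norm (\<Sum>r\<in>?G. g r * (e (r * w) - 1)) \<le> D * sqrt K * (N * card B)" by (simp add: mult_ac)
  then show ?thesis
    unfolding eq norm_divide using B0 N_pos by (simp add: norm_mult divide_le_eq)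
qed

text \<open>Otherwise h drops from 1 at a to 0 at a + w for every a in A. Comparing through H costs
  1/4 for the shift and, at each end, 1/8 plus an excess term; summed over A this gives |A| \<le>
  |A| / 2 + |A| / 8 + |A| / 8.\<close>

lemma exists_avg_ind_pos:
  fixes H :: "int \<Rightarrow> complex"
  assumes A: "A \<subseteq> {0..<int N}" "A \<noteq> {}" and one: "\<And>a. a \<in> A \<Longrightarrow> avg_ind S B a = 1"
    and exc: "excess (1/8) (\<lambda>x. H x - of_real (avg_ind S B x)) \<le> card A / 8"
    and H: "\<And>a. norm (H (a + w) - H a) \<le> 1/4" and per: "periodic H"
  shows "\<exists>a\<in>A. avg_ind S B (a + w) > 0"
proof (rule ccontr)
  assume "\<not> ?thesis"
  then have zero: "avg_ind S B (a + w) = 0" if "a \<in> A" for a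
    using that avg_ind_range(1)[of S B "a + w"] by force
  have finA: "finite A" using A finite_subset by blast
  let ?d = "\<lambda>x. H x - complex_of_real (avg_ind S B x)"
  let ?m = "\<lambda>x. max 0 (norm (?d x) - 1/8)"
  have le: "(\<Sum>a\<in>A. ?m a) \<le> card A / 8" "(\<Sum>a\<in>A. ?m (a + w)) \<le> card A / 8"
  proof -
    have "(\<Sum>a\<in>A. ?m a) \<le> (\<Sum>a\<in>{0..<int N}. ?m a)"
      using A by (intro sum_mono2) auto
    then show "(\<Sum>a\<in>A. ?m a) \<le> card A / 8" using exc by (simp add: excess_def)
    have "periodic ?m" using per periodic_avg_ind by (simp add: periodic_def)
    then have "(\<Sum>a\<in>{0..<int N}. ?m (a + w)) = (\<Sum>a\<in>{0..<int N}. ?m a)" by (rule sum_shift)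
    moreover have "(\<Sum>a\<in>A. ?m (a + w)) \<le> (\<Sum>a\<in>{0..<int N}. ?m (a + w))"
      using A by (intro sum_mono2) auto
    ultimately show "(\<Sum>a\<in>A. ?m (a + w)) \<le> card A / 8" using exc by (simp add: excess_def)
  qed
  have "real (card A) = (\<Sum>a\<in>A. 1)" by simp
  also have "\<dots> \<le> (\<Sum>a\<in>A. 1/2 + ?m a + ?m (a + w))"
  proof (rule sum_mono)
    fix a assume a: "a \<in> A"
    have "1 = norm (?d (a + w) - ?d a - (H (a + w) - H a))" using one[OF a] zero[OF a] by simp
    also have "\<dots> \<le> norm (?d (a + w)) + norm (?d a) + norm (H (a + w) - H a)"
      by (intro order.trans[OF norm_triangle_ineq4] add_right_mono norm_triangle_ineq4)
    finally show "1 \<le> 1/2 + ?m a + ?m (a + w)" using H[of a] by linarith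
  qed
  also have "\<dots> = card A / 2 + (\<Sum>a\<in>A. ?m a) + (\<Sum>a\<in>A. ?m (a + w))"
    by (simp add: sum.distrib)
  also have "\<dots> \<le> card A * (3/4)" using le by simp
  finally show False using finA A by simp
qed

text \<open>The value of \<eta> is such that k averaging steps, each with threshold 2 \<eta> and
  excess 2 \<eta> |A|, add up to the 1/8 and |A| / 8 that \<open>exists_avg_ind_pos\<close>
  tolerates.\<close>

lemma almost_periods_in_sumset:
  fixes K \<eta> :: real and k m :: nat
  defines "\<eta> \<equiv> 1 / (16 * real k)"
  assumes A: "A \<subseteq> {0..<int N}" "A \<noteq> {}" and B: "B \<subseteq> {0..<int N}" "B \<noteq> {}"
    and S: "S = (\<lambda>(a, b). (a + b) mod int N) ` (A \<times> B)" and K: "card S \<le> K * card B"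
    and k: "k > 0" "8 * sqrt K \<le> 4 ^ k"
    and m: "2 \<le> \<eta> * m" "4 * N * exp (- (\<eta>\<^sup>2 * m / 4)) \<le> \<eta> * card A"
  obtains L where "L \<subseteq> {0..<int N}" "card L \<le> 16 * ln (2 * K ^ m * N / card A)"
    "\<And>w \<theta>. sqrt K * (real (card L) * \<theta>) \<le> 1/4 \<Longrightarrow> (\<And>l. l \<in> L \<Longrightarrow> norm (e (l * w) - 1) \<le> \<theta>) \<Longrightarrow>
       \<exists>a\<in>A. \<exists>a'\<in>A. \<exists>b\<in>B. \<exists>b'\<in>B. int N dvd w - ((a' - a) + (b' - b))"
proof -
  have finA: "finite A" and finB: "finite B" using A B finite_subset by blast+
  have A0: "real (card A) > 0" and B0: "real (card B) > 0"
    using finA A finB B by (simp_all add: card_gt_0_iff)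
  have \<eta>: "0 < \<eta>" "\<eta> \<le> 1" using k by (auto simp: \<eta>_def)
  have SG: "S \<subseteq> {0..<int N}" using N_pos by (auto simp: S)
  have finS: "finite S" using SG finite_subset by blast
  have S0: "card S > 0" unfolding S card_gt_0_iff using A B finA finB by auto
  have K0: "K > 0"
    using K S0 B0 by (metis less_le_trans of_nat_0_less_iff zero_less_mult_pos2)
  obtain T where T: "T \<subseteq> A" "card A \<le> 2 * K ^ m * card T"
    and per: "\<And>t t'. t \<in> T \<Longrightarrow> t' \<in> T \<Longrightarrow>
       excess (2 * \<eta>) (\<lambda>x. avg_ind S B (x + t) - avg_ind S B (x + t')) \<le> 2 * (\<eta> * card A)"
  proof (rule exists_almost_periods[OF finA A(2) B finS _ K \<eta> m(1) _ m(2)])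
    show "(a + b) mod int N \<in> S" if "a \<in> A" "b \<in> B" for a b using that by (auto simp: S)
    show "0 < \<eta> * card A" using \<eta> A0 by simp
  qed blast
  have finT: "finite T" using T(1) finA finite_subset by blast
  have Tne: "T \<noteq> {}" using T(2) A0 by auto
  have T0: "real (card T) > 0" using finT Tne by (simp add: card_gt_0_iff)
  define H where "H = smoothed S B T k"
  have exc: "excess (1/8) (\<lambda>x. H x - of_real (avg_ind S B x)) \<le> card A / 8"
    using excess_smoothed[OF SG finT Tne per, of k] k by (simp add: H_def \<eta>_def field_simps)
  have one: "avg_ind S B a = 1" if "a \<in> A" for a
  proof -
    have "ind S (a + b) = 1" if "b \<in> B" for b using that \<open>a \<in> A\<close> by (auto simp: ind_def S)
    then show ?thesis using B0 by (simp add: avg_ind_def)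
  qed
  \<comment> \<open>The large spectrum of T at level 1/2. Only on these frequencies does w have to
    be controlled; all others are damped by 4^(-k).\<close>
  define Q where "Q = {r \<in> {0..<int N}. card T \<le> 2 * norm (esum T r)}"
  have "finite Q" unfolding Q_def by (rule finite_Collect_conjI) simp
  then obtain L where L: "L \<subseteq> Q" "dissociated L"
    and span: "\<And>r. r \<in> Q \<Longrightarrow> \<exists>\<epsilon>. (\<forall>l\<in>L. \<epsilon> l \<in> {-1, 0, 1}) \<and> int N dvd r - (\<Sum>l\<in>L. \<epsilon> l * l)"
    using dissociated_spanning by blast
  have finL: "finite L" using L \<open>finite Q\<close> finite_subset by blast
  show ?thesis
  proof (rule that)
    show "L \<subseteq> {0..<int N}" using L by (auto simp: Q_def)
    have "card L \<le> 16 * ln (N / card T)"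
      by (rule card_dissociated_le[OF order.trans[OF T(1) A(1)] Tne finL L(2)]) (use L in \<open>auto simp: Q_def\<close>)
    also have "ln (N / card T) \<le> ln (2 * K ^ m * N / card A)"
      using T0 A0 N_pos T(2) K0 by (intro ln_mono) (auto simp: field_simps)
    finally show "card L \<le> 16 * ln (2 * K ^ m * N / card A)" by simp
  next
    fix w and \<theta> :: real
    assume \<theta>: "sqrt K * (real (card L) * \<theta>) \<le> 1/4" and small: "\<And>l. l \<in> L \<Longrightarrow> norm (e (l * w) - 1) \<le> \<theta>"
    \<comment> \<open>A bound of 1 / (4 sqrt K) per frequency leaves 1/4 after the loss of sqrt K in
      \<open>norm_smoothed_diff_le\<close>.\<close>
    have "norm (H (y + w) - H y) \<le> 1 / (4 * sqrt K) * sqrt K" for y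
      unfolding H_def
    proof (rule norm_smoothed_diff_le[OF B SG K])
      fix r assume r: "r \<in> {0..<int N}"
      define \<rho> where "\<rho> = norm (esum T r) / card T"
      have \<rho>0: "0 \<le> \<rho>" by (simp add: \<rho>_def)
      show "\<rho> ^ (2 * k) * norm (e (r * w) - 1) \<le> 1 / (4 * sqrt K)"
      proof (cases "r \<in> Q")
        case True
        then obtain \<epsilon> where "\<And>l. l \<in> L \<Longrightarrow> \<epsilon> l \<in> {-1, 0, 1}"
            "int N dvd r - (\<Sum>l\<in>L. \<epsilon> l * l)"
          using span by blast
        note rw = norm_e_span_le[OF this small]
        have "norm (esum T r) \<le> (\<Sum>t\<in>T. 1)" unfolding esum_def by (rule sum_norm_le) simp
        then have "\<rho> \<le> 1" using T0 by (simp add: \<rho>_def)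
        then have "\<rho> ^ (2 * k) * norm (e (r * w) - 1) \<le> 1 * norm (e (r * w) - 1)"
          using \<rho>0 by (intro mult_right_mono power_le_one) auto
        also have "\<dots> \<le> card L * \<theta>"
          using rw by simp
        also have "\<dots> \<le> 1 / (4 * sqrt K)"
          using \<theta> K0 by (simp add: field_simps)
        finally show ?thesis .
      next
        case False
        then have "\<rho> \<le> 1/2" using r T0 by (simp add: Q_def \<rho>_def field_simps)
        then have "\<rho> ^ (2 * k) \<le> (1/2) ^ (2 * k)" using \<rho>0 by (rule power_mono)
        also have "\<dots> = 1 / 4 ^ k" by (simp add: power_mult power_one_over)
        also have "\<dots> \<le> 1 / (8 * sqrt K)" using k K0 by (intro divide_left_mono) auto
        finally have "\<rho> ^ (2 * k) * norm (e (r * w) - 1) \<le> 1 / (8 * sqrt K) * 2"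
          using norm_triangle_ineq4[of "e (r * w)" 1] K0 \<rho>0 by (intro mult_mono) auto
        then show ?thesis by simp
      qed
    qed
    then have H: "norm (H (y + w) - H y) \<le> 1/4" for y using K0 by simp
    have "periodic H" unfolding H_def by (rule periodic_smoothed)
    from exists_avg_ind_pos[OF A one exc H this]
    obtain a where a: "a \<in> A" and pos: "avg_ind S B (a + w) > 0" ..
    \<comment> \<open>A positive average puts some a + w + b into S, which consists of sums a' + b';
      solving the congruence for w gives the claim.\<close>
    have "\<exists>b\<in>B. ind S (a + w + b) \<noteq> 0"
    proof (rule ccontr)
      assume "\<not> ?thesis"
      then have "avg_ind S B (a + w) = 0" by (simp add: avg_ind_def)
      then show False using pos by simp
    qed
    then obtain b where b: "b \<in> B" "(a + w + b) mod int N \<in> S"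
      unfolding ind_def by (metis of_bool_eq(1))
    then obtain a' b' where ab: "a' \<in> A" "b' \<in> B" "(a + w + b) mod int N = (a' + b') mod int N"
      unfolding S by auto
    then have "int N dvd w - ((a' - a) + (b' - b))"
      by (simp add: mod_eq_dvd_iff algebra_simps)
    then show "\<exists>a\<in>A. \<exists>a'\<in>A. \<exists>b\<in>B. \<exists>b'\<in>B. int N dvd w - ((a' - a) + (b' - b))"
      using a b ab by blast
  qed
qed

end

section \<open>Choice of parameters\<close>

text \<open>With k of order ln K + 3 and m of order k^2 ln (k / \<alpha>), the logarithm is O((ln K
  + 3)^4 ln (1 / \<alpha>)), and K^(1/4) absorbs the fourth power. The bound \<alpha> \<le> 1/2
  keeps ln (1 / \<alpha>) away from 0, so that constants are absorbed as well.\<close>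

lemma exists_parameters:
  fixes K \<alpha> :: real
  assumes K: "1 \<le> K" and \<alpha>: "0 < \<alpha>" "\<alpha> \<le> 1/2"
  shows "\<exists>k m :: nat. k > 0 \<and> 8 * sqrt K \<le> 4 ^ k \<and> 2 \<le> 1 / (16 * real k) * m \<and>
    4 * exp (- ((1 / (16 * real k))\<^sup>2 * m / 4)) \<le> 1 / (16 * real k) * \<alpha> \<and>
    16 * ln (2 * K ^ m / \<alpha>) \<le> 10 ^ 10 * K powr (1/4) * ln (inverse \<alpha>)"
proof -
  define l where "l = ln K"
  define L where "L = ln (inverse \<alpha>)"
  have l0: "l \<ge> 0" using K by (simp add: l_def)
  have "ln 2 \<le> L" unfolding L_def using \<alpha> by (intro ln_mono) (auto simp: field_simps)
  then have L: "L \<ge> 1/2" using ln2_ge_two_thirds by linarith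
  \<comment> \<open>Since exp 1 < 4, the ceiling of l gives sqrt K \<le> K \<le> 4 ^ nat
    \<lceil>l\<rceil>; the additional 2 supplies the factor 8.\<close>
  define k where "k = nat \<lceil>l\<rceil> + 2"
  define u where "u = l + 3"
  have u3: "u \<ge> 3" using l0 by (simp add: u_def)
  have k: "2 \<le> real k" "real k \<le> u" "l \<le> nat \<lceil>l\<rceil>"
    using l0 by (auto simp: k_def u_def) linarith+
  have k4: "8 * sqrt K \<le> 4 ^ k"
  proof -
    have "sqrt K \<le> K" using K by (intro real_le_lsqrt) (auto simp: power2_eq_square)
    also have "K = exp l" using K by (simp add: l_def)
    also have "\<dots> \<le> exp (real (nat \<lceil>l\<rceil>) * 1)" using k(3) by simp
    also have "\<dots> = exp 1 ^ nat \<lceil>l\<rceil>" by (rule exp_of_nat_mult)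
    also have "\<dots> \<le> 4 ^ nat \<lceil>l\<rceil>" using exp_le by (intro power_mono) auto
    also have "\<dots> \<le> 2 * 4 ^ nat \<lceil>l\<rceil>" by simp
    finally have "8 * sqrt K \<le> 16 * 4 ^ nat \<lceil>l\<rceil>" by simp
    then show ?thesis by (simp add: k_def power_add)
  qed
  \<comment> \<open>With \<eta> = 1 / (16 k) one has \<eta>^2 m / 4 = m / (1024 k^2), which this m
    makes at least v, and 4 exp (- v) = \<eta> \<alpha>.\<close>
  define v where "v = ln (64 * k / \<alpha>)"
  define m where "m = nat \<lceil>1024 * (real k)\<^sup>2 * v\<rceil>"
  have arg: "128 \<le> 64 * k / \<alpha>" using k \<alpha> by (simp add: field_simps)
  have v1: "1 \<le> v"
    unfolding v_def using arg exp_le by (subst ln_ge_iff) linarith+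
  have v7: "v \<le> 7 * (u * L)"
  proof -
    have "v = 6 * ln 2 + ln k + L"
      using k \<alpha> ln_realpow[of 2 6] by (simp add: v_def L_def ln_mult ln_div ln_inverse)
    also have "\<dots> \<le> 6 + u + L"
      using ln_2_less_1 ln_le_minus_one[of "real k"] k by linarith
    also have "\<dots> \<le> 3 * u + L" using u3 by linarith
    also have "\<dots> \<le> 7 * (u * L)"
      using mult_mono[of 3 u "1/2" L] mult_left_mono[OF L, of u] mult_right_mono[OF u3, of L] u3 L
      by linarith
    finally show ?thesis .
  qed
  have mv: "1024 * (real k)\<^sup>2 * v \<le> m" unfolding m_def by linarith
  have m2: "2 \<le> 1 / (16 * real k) * m"
  proof -
    have "32 * real k \<le> 1024 * ((real k)\<^sup>2 * 1)" using k by (simp add: power2_eq_square)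
    also have "\<dots> \<le> 1024 * ((real k)\<^sup>2 * v)" using v1 by (intro mult_left_mono) auto
    also have "\<dots> \<le> m" using mv by simp
    finally show ?thesis using k by (simp add: field_simps)
  qed
  have ex: "4 * exp (- ((1 / (16 * real k))\<^sup>2 * m / 4)) \<le> 1 / (16 * real k) * \<alpha>"
  proof -
    have "v \<le> (1 / (16 * real k))\<^sup>2 * m / 4"
      using mv k by (simp add: field_simps power2_eq_square)
    then have "4 * exp (- ((1 / (16 * real k))\<^sup>2 * m / 4)) \<le> 4 * exp (- v)" by simp
    also have "\<dots> = 1 / (16 * real k) * \<alpha>"
      using arg k \<alpha> by (simp add: exp_minus v_def field_simps)
    finally show ?thesis .
  qed
  have m_le: "m \<le> 7169 * (u ^ 3 * L)"
  proof -
    have "1 \<le> u ^ 3 * L"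
      using mult_mono[of "3 ^ 3" "u ^ 3" "1/2" L] power_mono[OF u3, of 3] L u3 by simp
    moreover have "m \<le> 1024 * ((real k)\<^sup>2 * v) + 1"
      unfolding m_def using v1 by (simp add: mult.assoc)
    moreover have "(real k)\<^sup>2 * v \<le> u\<^sup>2 * (7 * (u * L))"
      using k v1 v7 by (intro mult_mono power_mono) auto
    moreover have "u\<^sup>2 * (7 * (u * L)) = 7 * (u ^ 3 * L)"
      by (simp add: power2_eq_square power3_eq_cube)
    ultimately show ?thesis by linarith
  qed
  have "ln (2 * K ^ m / \<alpha>) = ln 2 + m * l + L"
    using K \<alpha> by (simp add: l_def L_def ln_mult ln_div ln_realpow ln_inverse)
  also have "\<dots> \<le> 7170 * (u ^ 4 * L)"
  proof -
    have "m * l \<le> 7169 * (u ^ 3 * L) * u"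
      using m_le l0 L u3 by (intro mult_mono) (auto simp: u_def)
    also have "\<dots> = 7169 * (u ^ 4 * L)" by (simp add: power4_eq_xxxx power3_eq_cube)
    finally have "m * l \<le> 7169 * (u ^ 4 * L)" .
    moreover have "3 \<le> u ^ 4" using power_mono[OF u3, of 4] by simp
    then have "3 * L \<le> u ^ 4 * L" using L by (intro mult_right_mono) auto
    moreover have "ln 2 \<le> (1::real)" using ln_2_less_1 by simp
    ultimately show ?thesis using L by linarith
  qed
  \<comment> \<open>Take the fourth power of u \<le> 16 (1 + l / 16) \<le> 16 exp (l / 16).\<close>
  also have "u ^ 4 \<le> 65536 * K powr (1/4)"
  proof -
    have "u \<le> 16 * exp (l / 16)" using exp_ge_add_one_self[of "l / 16"] unfolding u_def by linarith
    then have "u ^ 4 \<le> (16 * exp (l / 16)) ^ 4" using u3 by (intro power_mono) auto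
    also have "\<dots> = 65536 * exp (l / 4)"
      by (simp add: power_mult_distrib flip: exp_of_nat_mult)
    also have "exp (l / 4) = K powr (1/4)" using K by (simp add: powr_def l_def)
    finally show ?thesis .
  qed
  finally have "ln (2 * K ^ m / \<alpha>) \<le> 469893120 * (K powr (1/4) * L)"
    using L by simp
  moreover have "0 \<le> K powr (1/4) * L" using L by simp
  ultimately have "16 * ln (2 * K ^ m / \<alpha>) \<le> 10000000000 * (K powr (1/4) * L)" by linarith
  then show ?thesis using k k4 m2 ex by (intro exI[of _ k] exI[of _ m]) (auto simp: L_def)
qed

section \<open>Passage to \<open>integer_mod_group N\<close> and its characters\<close>

context cyclic begin

lemma carrier_eq: "carrier (integer_mod_group N) = {0..<int N}"
  using N_pos by (simp add: carrier_integer_mod_group)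

lemma mem_sumset:
  assumes A: "A \<subseteq> {0..<int N}" and B: "B \<subseteq> {0..<int N}" and w: "w \<in> {0..<int N}"
    and ab: "a \<in> A" "a' \<in> A" "b \<in> B" "b' \<in> B" "int N dvd w - ((a' - a) + (b' - b))"
  shows "w \<in> diff_set (integer_mod_group N) A A <#>\<^bsub>integer_mod_group N\<^esub>
             diff_set (integer_mod_group N) B B"
proof -
  let ?Z = "integer_mod_group N"
  have car: "a \<in> carrier ?Z" "b \<in> carrier ?Z" using ab A B by (auto simp: carrier_eq)
  have "w = w mod int N" using w by simp
  also have "\<dots> = ((a' - a) + (b' - b)) mod int N" using ab(5) by (simp add: mod_eq_dvd_iff)
  also have "\<dots> = ((a' \<otimes>\<^bsub>?Z\<^esub> inv\<^bsub>?Z\<^esub> a) \<otimes>\<^bsub>?Z\<^esub> (b' \<otimes>\<^bsub>?Z\<^esub> inv\<^bsub>?Z\<^esub> b))"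
    using car by (simp add: mod_simps)
  finally show ?thesis
    unfolding set_mult_def diff_set_def using ab by blast
qed

text \<open>A and its translate by w have more than N elements in total, so they meet.\<close>

lemma diff_set_full:
  assumes A: "A \<subseteq> {0..<int N}" and big: "N < 2 * card A" and w: "w \<in> {0..<int N}"
  shows "\<exists>a\<in>A. \<exists>a'\<in>A. int N dvd w - (a' - a)"
proof -
  let ?f = "\<lambda>a. (a + w) mod int N"
  have finA: "finite A" using A finite_subset by blast
  have "inj_on ?f A" using bij_betw_shift A inj_on_subset unfolding bij_betw_def by blast
  then have card: "card (?f ` A) = card A" by (rule card_image)
  have "A \<inter> ?f ` A \<noteq> {}"
  proof
    assume "A \<inter> ?f ` A = {}"
    then have "card (A \<union> ?f ` A) = 2 * card A" using finA card by (simp add: card_Un_disjoint)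
    moreover have "card (A \<union> ?f ` A) \<le> card {0..<int N}"
      using A N_pos by (intro card_mono) auto
    ultimately show False using big by simp
  qed
  then obtain a a' where "a \<in> A" "a' \<in> A" "a' = ?f a" by blast
  moreover from this have "a' mod int N = (a + w) mod int N" by simp
  then have "int N dvd w - (a' - a)" by (simp add: mod_eq_dvd_iff dvd_diff_commute algebra_simps)
  ultimately show ?thesis by blast
qed

text \<open>The restriction provides the extensionality demanded by
  \<open>characters\<close>.\<close>

definition character :: "int \<Rightarrow> int \<Rightarrow> complex" where
  "character l = (\<lambda>x\<in>{0..<int N}. e (l * x))"

lemma character_in_characters: "character l \<in> characters N"
proof -
  have "e (l * ((x + y) mod int N)) = e (l * x) * e (l * y)" for x y
    by (simp add: e_mult_mod e_add distrib_left)
  then show ?thesis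
    using N_pos by (auto simp: characters_def hom_def carrier_eq circle_group_def character_def)
qed

lemma bohr_in_sumset:
  fixes K \<alpha> :: real
  assumes A: "A \<subseteq> {0..<int N}" "A \<noteq> {}" and B: "B \<subseteq> {0..<int N}" "B \<noteq> {}"
    and K: "card (A <#>\<^bsub>integer_mod_group N\<^esub> B) \<le> K * card B"
    and \<alpha>: "\<alpha> = card A / N" "\<alpha> < 1"
  obtains \<Gamma> \<delta> where "\<Gamma> \<subseteq> characters N" "0 < \<delta>" "\<delta> \<le> 1"
    "bohr_set N \<Gamma> \<delta> \<subseteq> diff_set (integer_mod_group N) A A <#>\<^bsub>integer_mod_group N\<^esub>
       diff_set (integer_mod_group N) B B"
    "card \<Gamma> \<le> 10 ^ 11 * (K powr (1/2) * ln (inverse \<alpha>))"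
    "ln (inverse \<delta>) \<le> 10 ^ 11 * (K powr (1/4) * ln (inverse \<alpha>) * ln (K * inverse \<alpha>))"
proof -
  let ?Z = "integer_mod_group N"
  have finA: "finite A" and finB: "finite B" using A B finite_subset by blast+
  have A0: "real (card A) > 0" and B0: "real (card B) > 0"
    using finA A finB B by (simp_all add: card_gt_0_iff)
  have \<alpha>0: "0 < \<alpha>" using A0 N_pos by (simp add: \<alpha>)
  define S where "S = (\<lambda>(a, b). (a + b) mod int N) ` (A \<times> B)"
  have S: "A <#>\<^bsub>?Z\<^esub> B = S" by (auto simp: set_mult_def S_def)
  \<comment> \<open>A + B contains a translate of B, which forces K \<ge> 1.\<close>
  have "card B \<le> card S"
  proof -
    obtain a where a: "a \<in> A" using A by blast
    have "inj_on (\<lambda>b. (b + a) mod int N) B"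
      using bij_betw_shift B inj_on_subset unfolding bij_betw_def by blast
    moreover have "(\<lambda>b. (b + a) mod int N) ` B \<subseteq> S"
      using a by (auto simp: S_def add.commute[of _ a])
    ultimately show ?thesis using finA finB by (intro card_inj_on_le) (auto simp: S_def)
  qed
  then have "1 * real (card B) \<le> K * card B" using K unfolding S by linarith
  then have K1: "1 \<le> K" using B0 by simp
  have L0: "0 \<le> ln (inverse \<alpha>)" using \<alpha>(2) \<alpha>0 by (simp add: ln_inverse)
  have LK0: "0 \<le> ln (K * inverse \<alpha>)"
    using \<alpha>(2) \<alpha>0 K1 mult_mono[of 1 K 1 "inverse \<alpha>"] by (simp add: one_le_inverse_iff)
  show ?thesis
  proof (cases "\<alpha> \<le> 1/2")
    \<comment> \<open>As \<alpha> tends to 1 the permitted bounds tend to 0. The empty set of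
      characters with \<delta> = 1 makes both left-hand sides 0.\<close>
    case False
    then have big: "N < 2 * card A" using N_pos by (simp add: \<alpha> field_simps)
    obtain b where b: "b \<in> B" using B by blast
    show ?thesis
    proof (rule that[of "{}" 1])
      show "bohr_set N {} 1 \<subseteq> diff_set ?Z A A <#>\<^bsub>?Z\<^esub> diff_set ?Z B B"
      proof
        fix w assume "w \<in> bohr_set N {} 1"
        then have w: "w \<in> {0..<int N}" by (simp add: bohr_set_def carrier_eq)
        from diff_set_full[OF A(1) big w] obtain a a'
          where "a \<in> A" "a' \<in> A" "int N dvd w - (a' - a)" by blast
        then show "w \<in> diff_set ?Z A A <#>\<^bsub>?Z\<^esub> diff_set ?Z B B"
          using mem_sumset[OF A(1) B(1) w _ _ b b, of a a'] by simp
      qed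
    qed (use L0 LK0 in auto)
  next
    case True
    define L where "L = ln (inverse \<alpha>)"
    have "ln 2 \<le> L" unfolding L_def using \<alpha>0 True by (intro ln_mono) (auto simp: field_simps)
    then have Lh: "L \<ge> 1/2" using ln2_ge_two_thirds by linarith
    define p where "p = K powr (1/4)"
    have p1: "1 \<le> p" using K1 by (simp add: p_def ge_one_powr_ge_zero)
    obtain k m :: nat where km: "k > 0" "8 * sqrt K \<le> 4 ^ k" "2 \<le> 1 / (16 * real k) * m"
      "4 * exp (- ((1 / (16 * real k))\<^sup>2 * m / 4)) \<le> 1 / (16 * real k) * \<alpha>"
      "16 * ln (2 * K ^ m / \<alpha>) \<le> 10 ^ 10 * p * L"
      using exists_parameters[OF K1 \<alpha>0 True] unfolding p_def L_def by blast
    have "4 * N * exp (- ((1 / (16 * real k))\<^sup>2 * m / 4)) \<le> 1 / (16 * real k) * card A"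
      using mult_left_mono[OF km(4), of N] N_pos by (simp add: \<alpha> mult_ac)
    then obtain X where X: "X \<subseteq> {0..<int N}" "card X \<le> 16 * ln (2 * K ^ m * N / card A)"
      and X_sumset: "\<And>w \<theta>. sqrt K * (real (card X) * \<theta>) \<le> 1/4 \<Longrightarrow> (\<And>l. l \<in> X \<Longrightarrow> norm (e (l * w) - 1) \<le> \<theta>) \<Longrightarrow>
       \<exists>a\<in>A. \<exists>a'\<in>A. \<exists>b\<in>B. \<exists>b'\<in>B. int N dvd w - ((a' - a) + (b' - b))"
      using almost_periods_in_sumset[OF A B S_def K[unfolded S] km(1-3)] by blast
    have finX: "finite X" using X finite_subset by blast
    have cX: "card X \<le> 10 ^ 10 * (p * L)"
      using X(2) km(5) by (simp add: \<alpha> mult_ac)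
    \<comment> \<open>Chosen so that sqrt K * |X| * 2 pi \<delta> \<le> 1/4; the + 1 keeps \<delta>
      positive when X is empty.\<close>
    define \<delta> where "\<delta> = 1 / (8 * pi * sqrt K * (real (card X) + 1))"
    have "1 \<le> 8 * pi * sqrt K * (real (card X) + 1)"
    proof -
      have "1 * 1 * 1 \<le> (8 * pi) * sqrt K * (real (card X) + 1)"
        using pi_gt3 K1 by (intro mult_mono) auto
      then show ?thesis by simp
    qed
    then have \<delta>: "0 < \<delta>" "\<delta> \<le> 1" by (auto simp: \<delta>_def)
    show ?thesis
    proof (rule that[OF _ \<delta>])
      show "character ` X \<subseteq> characters N" using character_in_characters by blast
      show "bohr_set N (character ` X) \<delta> \<subseteq> diff_set ?Z A A <#>\<^bsub>?Z\<^esub> diff_set ?Z B B"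
      proof
        fix w assume bw: "w \<in> bohr_set N (character ` X) \<delta>"
        then have w: "w \<in> {0..<int N}" by (simp add: bohr_set_def carrier_eq)
        have small: "norm (e (l * w) - 1) \<le> 2 * pi * \<delta>" if "l \<in> X" for l
        proof -
          have "circle_norm (e (l * w)) \<le> \<delta>"
            using bw that w by (auto simp: bohr_set_def character_def)
          then have "2 * pi * circle_norm (e (l * w)) \<le> 2 * pi * \<delta>" by (intro mult_left_mono) auto
          then show ?thesis using norm_e_diff_1_le[of "l * w"] by linarith
        qed
        have "sqrt K * (card X * (2 * pi * \<delta>)) \<le> 1/4"
          using K1 by (simp add: \<delta>_def divide_simps)
        then obtain a a' b b' where "a \<in> A" "a' \<in> A" "b \<in> B" "b' \<in> B" "int N dvd w - ((a' - a) + (b' - b))"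
          using X_sumset[OF _ small] by blast
        then show "w \<in> diff_set ?Z A A <#>\<^bsub>?Z\<^esub> diff_set ?Z B B"
          using mem_sumset[OF A(1) B(1) w] by blast
      qed
      have "real (card (character ` X)) \<le> card X" using card_image_le[OF finX] by simp
      also have "\<dots> \<le> 10 ^ 10 * (p * L)" by (rule cX)
      also have "\<dots> \<le> 10 ^ 11 * (K powr (1/2) * L)"
        using K1 Lh by (intro mult_mono) (auto simp: p_def intro: powr_mono)
      finally show "card (character ` X) \<le> 10 ^ 11 * (K powr (1/2) * ln (inverse \<alpha>))"
        by (simp add: L_def)
      \<comment> \<open>The product of the two logarithms in the bound for \<delta>. A constant plus
        ln K + L bounds ln (1 / \<delta>); M \<ge> 1/4 absorbs the constant and ln K + L \<le> 2 M
        the rest, after which the factor p \<ge> 1 is put in.\<close>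
      define M where "M = L * (ln K + L)"
      have lK: "0 \<le> ln K" using K1 by simp
      have M4: "1/4 \<le> M"
        using mult_mono[of "1/2" L "1/2" "ln K + L"] Lh lK by (simp add: M_def)
      have M2: "ln K + L \<le> 2 * M"
        using mult_right_mono[OF Lh, of "ln K + L"] Lh lK by (simp add: M_def)
      have pL: "1/2 \<le> p * L" using mult_mono[OF p1 Lh] p1 by simp
      have "ln (real (card X) + 1) \<le> ln ((2 * 10 ^ 10) * (p * L))"
        using cX pL by (intro ln_mono) auto
      also have "\<dots> = ln (2 * 10 ^ 10) + ln p + ln L"
        using p1 Lh by (simp add: ln_mult)
      also have "\<dots> \<le> 2 * 10 ^ 10 + ln K / 4 + L"
        using ln_le_minus_one[of "2 * 10 ^ 10 :: real"] ln_le_minus_one[of L] Lh K1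
        by (simp add: p_def ln_powr)
      finally have lnX: "ln (real (card X) + 1) \<le> 2 * 10 ^ 10 + ln K / 4 + L" .
      have "ln (inverse \<delta>) = ln (8 * pi) + ln (sqrt K) + ln (real (card X) + 1)"
        using K1 by (simp add: \<delta>_def ln_mult)
      also have "\<dots> \<le> 32 + ln K / 2 + (2 * 10 ^ 10 + ln K / 4 + L)"
        using ln_le_minus_one[of "8 * pi"] pi_less_4 lnX K1 by (simp add: ln_sqrt)
      also have "\<dots> \<le> 10 ^ 11 * M" using M4 M2 lK by simp
      also have "\<dots> \<le> 10 ^ 11 * (p * M)" using p1 M4 by simp
      finally show "ln (inverse \<delta>) \<le> 10 ^ 11 * (K powr (1/4) * ln (inverse \<alpha>) * ln (K * inverse \<alpha>))"
        using K1 \<alpha>0 by (simp add: p_def M_def L_def ln_mult)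
    qed
  qed
qed

end

theorem theorem1p3:
  "\<exists>C > 0. \<forall>(N :: nat) (A :: int set) (B :: int set) (K :: real) (\<alpha> :: real).
     N > 0 \<and> A \<subseteq> carrier (integer_mod_group N) \<and> B \<subseteq> carrier (integer_mod_group N) \<and>
     A \<noteq> {} \<and> B \<noteq> {} \<and>
     real (card (A <#>\<^bsub>integer_mod_group N\<^esub> B)) \<le> K * real (card B) \<and>
     \<alpha> = real (card A) / real N \<and> 0 < \<alpha> \<and> \<alpha> < 1
     \<longrightarrow> (\<exists>\<Gamma> \<Lambda> \<delta> \<epsilon>.
           \<Gamma> \<subseteq> characters N \<and> \<Lambda> \<subseteq> characters N \<and>
           0 < \<delta> \<and> \<delta> \<le> 1 \<and> 0 < \<epsilon> \<and> \<epsilon> \<le> 1 \<and>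
           bohr_set N \<Gamma> \<delta> \<inter> bohr_set N \<Lambda> \<epsilon> \<subseteq>
             diff_set (integer_mod_group N) A A <#>\<^bsub>integer_mod_group N\<^esub>
             diff_set (integer_mod_group N) B B \<and>
           \<bar>real (card \<Gamma>)\<bar> \<le> C * \<bar>K powr (1/2) * ln (inverse \<alpha>)\<bar> \<and>
           \<bar>ln (inverse \<delta>)\<bar> \<le> C * \<bar>K powr (1/4) * ln (inverse \<alpha>) * ln (K * inverse \<alpha>)\<bar> \<and>
           \<bar>real (card \<Lambda>)\<bar> \<le> C * \<bar>K powr (3/4) * ln (inverse \<alpha>)\<bar> \<and>
           \<bar>ln (inverse \<epsilon>)\<bar> \<le> C * \<bar>ln (K * ln (inverse \<alpha>))\<bar>)"
proof (intro exI[of _ "10 ^ 11"] conjI allI impI)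
  fix N :: nat and A B :: "int set" and K \<alpha> :: real
  let ?Z = "integer_mod_group N"
  assume asm: "N > 0 \<and> A \<subseteq> carrier ?Z \<and> B \<subseteq> carrier ?Z \<and> A \<noteq> {} \<and> B \<noteq> {} \<and>
     real (card (A <#>\<^bsub>?Z\<^esub> B)) \<le> K * real (card B) \<and>
     \<alpha> = real (card A) / real N \<and> 0 < \<alpha> \<and> \<alpha> < 1"
  interpret cyclic N using asm by unfold_locales simp
  obtain \<Gamma> \<delta> where \<Gamma>: "\<Gamma> \<subseteq> characters N" "0 < \<delta>" "\<delta> \<le> 1"
    "bohr_set N \<Gamma> \<delta> \<subseteq> diff_set ?Z A A <#>\<^bsub>?Z\<^esub> diff_set ?Z B B"
    "card \<Gamma> \<le> 10 ^ 11 * (K powr (1/2) * ln (inverse \<alpha>))"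
    "ln (inverse \<delta>) \<le> 10 ^ 11 * (K powr (1/4) * ln (inverse \<alpha>) * ln (K * inverse \<alpha>))"
  proof (rule bohr_in_sumset[of A B K \<alpha>])
    show "A \<subseteq> {0..<int N}" "B \<subseteq> {0..<int N}" using asm unfolding carrier_eq by blast+
  qed (use asm in blast)+
  have mono: "x \<le> 10 ^ 11 * y \<Longrightarrow> x \<le> 10 ^ 11 * \<bar>y\<bar>" for x y :: real
    by (erule order.trans) simp
  have "0 \<le> ln (inverse \<delta>)" using \<Gamma> by (simp add: ln_inverse)
  then have "\<bar>ln (inverse \<delta>)\<bar> \<le> 10 ^ 11 * \<bar>K powr (1/4) * ln (inverse \<alpha>) * ln (K * inverse \<alpha>)\<bar>"
    using mono[OF \<Gamma>(6)] by linarith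
  then show "\<exists>\<Gamma> \<Lambda> \<delta> \<epsilon>.
           \<Gamma> \<subseteq> characters N \<and> \<Lambda> \<subseteq> characters N \<and>
           0 < \<delta> \<and> \<delta> \<le> 1 \<and> 0 < \<epsilon> \<and> \<epsilon> \<le> 1 \<and>
           bohr_set N \<Gamma> \<delta> \<inter> bohr_set N \<Lambda> \<epsilon> \<subseteq>
             diff_set ?Z A A <#>\<^bsub>?Z\<^esub> diff_set ?Z B B \<and>
           \<bar>real (card \<Gamma>)\<bar> \<le> 10 ^ 11 * \<bar>K powr (1/2) * ln (inverse \<alpha>)\<bar> \<and>
           \<bar>ln (inverse \<delta>)\<bar> \<le> 10 ^ 11 * \<bar>K powr (1/4) * ln (inverse \<alpha>) * ln (K * inverse \<alpha>)\<bar> \<and>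
           \<bar>real (card \<Lambda>)\<bar> \<le> 10 ^ 11 * \<bar>K powr (3/4) * ln (inverse \<alpha>)\<bar> \<and>
           \<bar>ln (inverse \<epsilon>)\<bar> \<le> 10 ^ 11 * \<bar>ln (K * ln (inverse \<alpha>))\<bar>"
    \<comment> \<open>\<open>bohr_set N {} 1\<close> is the whole group, and \<open>card {}\<close>
      and \<open>ln (inverse 1)\<close> are 0, so the bounds for \<Lambda> and \<epsilon> hold
      whatever the sign of \<open>ln (K * ln (inverse \<alpha>))\<close>.\<close>
    using \<Gamma> mono[OF \<Gamma>(5)]
    by (intro exI[of _ \<Gamma>] exI[of _ "{}"] exI[of _ \<delta>] exI[of _ 1]) auto
qed simp

end
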